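(* Suppose that the numerical flux $\hat f$ is an E-flux. Then every solution $u(\cdot,t)\in\mathbb V^k$ of Scheme B satisfies the local semi-discrete entropy inequality $$\frac{d}{dt}\int_{I_j}U(u)\,dx+\hat{\mathcal F}_{j+\frac12}-\hat{\mathcal F}_{j-\frac12}\le 0,\qquad j=1,\dots,N,$$ where $\hat{\mathcal F}_{j+\frac12}=\hat{\mathcal F}(u^-_{j+\frac12},u^+_{j+\frac12})$ and $$\hat{\mathcal F}(u^-,u^+):=U'(u^-)\hat f(u^-,u^+)-\psi(u^-).$$
   Context: Let $f:\mathbb R\to\mathbb R$ be smooth (conservation law $u_t+f(u)_x=0$ on an interval $I$). Let $U\in C^3(\mathbb R)$ be strictly convex ($U''>0$ on $\mathbb R$), $\mathcal F$ an entropy flux with $\mathcal F'(u)=U'(u)f'(u)$, and $\psi(u):=U'(u)f(u)-\mathcal F(u)$. The interval $I$ is divided into cells $I_j=[x_{j-\frac12},x_{j+\frac12}]$, $j=1,\dots,N$, $h_j=|I_j|$. Fix $k\ge1$; $\mathbb V^k=\{v\in L^2(I): v|_{I_j}\in\mathbb P^k(I_j)\ \forall j\}$ ($\mathbb P^k$: polynomials of degree $\le k$); $\pi$ is the $L^2$-projection onto $\mathbb V^k$; $v^\pm_{j+\frac12}=v(x^\pm_{j+\frac12})$; $\overline u_j$ is the average of $u$ on $I_j$; the exterior traces at the end-points of $I$ are supplied by the boundary conditions. Put $\hat f_{j+\frac12}=\hat f(u^-_{j+\frac12},u^+_{j+\frac12})$ and $$H^+_{j-\frac12}=\hat f_{j-\frac12}-f(u^+_{j-\frac12}),\qquad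 H^-_{j+\frac12}=-\hat f_{j+\frac12}+f(u^-_{j+\frac12}).$$ E-flux: $\hat f$ is consistent ($\hat f(u,u)=f(u)$), locally Lipschitz continuous, and $(\hat f(u^-,u^+)-f(u))(u^+-u^-)\le0$ for all $u$ between $u^-$ and $u^+$. Constants: $C_k>0$ is the optimal constant with $\|p\|_{L^4(I_j)}\le \sqrt{C_k}\,h_j^{-1/4}\|p\|_{L^2(I_j)}$ for all $p\in\mathbb P^k(I_j)$. $\beta_k$ is a constant depending only on $k$ (for instance $(k+1)^4$ is admissible) such that, for every $U\in C^3(\mathbb R)$, $u\in\mathbb V^k$ and $j$, both $|\pi[U'(u)-U'(u^+_{j-\frac12})](x^+_{j-\frac12})|$ and $|\pi[U'(u)-U'(u^-_{j+\frac12})](x^-_{j+\frac12})|$ are at most $\frac{\beta_k}{2h_j}\max_{x\in I_j}|U'''(u(x))|\int_{I_j}|u-\overline u_j|^2dx$. Damping coefficient: $$B_j[u;U]:=\frac{\max_{x\in I_j}|U'''(u(x))|}{\min_{x\in I_j}|U''(u(x))|}\Big\{\frac{C_k}{2\sqrt{h_j}}\|f(u)_x-\pi[f(u)_x]\|_{L^2(I_j)}+\frac{\beta_k}{2h_j}\big(|H^+_{j-\frac12}|+|H^-_{j+\frac12}|\big)\Big\}.$$ On each cell, $f(u)_x$ means the derivative in the interior of the cell, and maxima/minima over $I_j$ use the polynomial $u|_{I_j}$. Scheme B: seek $u(\cdot,t)\in\mathbb V^k$ such that for all $v\in\mathbb V^k$ and all $j$, $$\int_{I_j}u_tv\,dx-\int_{I_j}f(u)v_x\,dx+\hat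 f_{j+\frac12}v^-_{j+\frac12}-\hat f_{j-\frac12}v^+_{j-\frac12}=-B_j[u;U]\int_{I_j}(u-\overline u_j)v\,dx.$$ *)

theory Defs
  imports "HOL-Analysis.Analysis" "HOL-Computational_Algebra.Polynomial"
begin

definition C_diff :: "nat \<Rightarrow> (real \<Rightarrow> real) \<Rightarrow> bool" where
  "C_diff n g \<longleftrightarrow>
     (\<forall>m<n. \<forall>y. (deriv ^^ m) g differentiable (at y)) \<and> continuous_on UNIV ((deriv ^^ n) g)"

definition smooth_fun :: "(real \<Rightarrow> real) \<Rightarrow> bool" where
  "smooth_fun g \<longleftrightarrow> (\<forall>n. C_diff n g)"

(* The grid point x_{j+1/2} is represented by x j, j = 0, ..., N. *)

definition mesh :: "nat \<Rightarrow> (nat \<Rightarrow> real) \<Rightarrow> bool" where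
  "mesh N x \<longleftrightarrow> N \<ge> 1 \<and> (\<forall>j<N. x j < x (Suc j))"

definition cell :: "(nat \<Rightarrow> real) \<Rightarrow> nat \<Rightarrow> real set" where
  "cell x j = {x (j - 1)..x j}"

(* A piecewise polynomial v is represented by the family of its cell polynomials, v j being the
   restriction of v to the cell I_j (1 <= j <= N); other indices are irrelevant. The one-sided
   limits of v at the end-points of I_j are the values of v j there. *)

definition Vk :: "nat \<Rightarrow> nat \<Rightarrow> (nat \<Rightarrow> real poly) set" where
  "Vk k N = {v. \<forall>j\<in>{1..N}. degree (v j) \<le> k}"

(* Traces v^-_{j+1/2} and v^+_{j+1/2} for j = 0, ..., N; gl and gr are the exterior traces at
   the left and right end-point of I. *)

definition trace_minus :: "(nat \<Rightarrow> real) \<Rightarrow> real \<Rightarrow> (nat \<Rightarrow> real poly) \<Rightarrow> nat \<Rightarrow> real" where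
  "trace_minus x gl v j = (if j = 0 then gl else poly (v j) (x j))"

definition trace_plus :: "nat \<Rightarrow> (nat \<Rightarrow> real) \<Rightarrow> real \<Rightarrow> (nat \<Rightarrow> real poly) \<Rightarrow> nat \<Rightarrow> real" where
  "trace_plus N x gr v j = (if j = N then gr else poly (v (Suc j)) (x j))"

definition L2_norm_on :: "real \<Rightarrow> real \<Rightarrow> (real \<Rightarrow> real) \<Rightarrow> real" where
  "L2_norm_on a b g = sqrt (integral {a..b} (\<lambda>y. (g y)\<^sup>2))"

definition L4_norm_on :: "real \<Rightarrow> real \<Rightarrow> (real \<Rightarrow> real) \<Rightarrow> real" where
  "L4_norm_on a b g = root 4 (integral {a..b} (\<lambda>y. (g y) ^ 4))"

definition cell_avg :: "real \<Rightarrow> real \<Rightarrow> (real \<Rightarrow> real) \<Rightarrow> real" where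
  "cell_avg a b g = integral {a..b} g / (b - a)"

(* The L2-projection onto piecewise polynomials acts cell by cell; this is its action on the
   cell [a,b]. *)

definition l2_proj :: "nat \<Rightarrow> real \<Rightarrow> real \<Rightarrow> (real \<Rightarrow> real) \<Rightarrow> real poly" where
  "l2_proj k a b g = (THE q. degree q \<le> k \<and>
     (\<forall>v. degree v \<le> k \<longrightarrow> integral {a..b} (\<lambda>y. (g y - poly q y) * poly v y) = 0))"

definition E_flux :: "(real \<Rightarrow> real) \<Rightarrow> (real \<Rightarrow> real \<Rightarrow> real) \<Rightarrow> bool" where
  "E_flux f fh \<longleftrightarrow>
     (\<forall>w. fh w w = f w) \<and>
     (\<forall>p. \<exists>e>0. \<exists>L. L-lipschitz_on (ball p e) (\<lambda>(a, b). fh a b)) \<and>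
     (\<forall>a b w. min a b \<le> w \<and> w \<le> max a b \<longrightarrow> (fh a b - f w) * (b - a) \<le> 0)"

(* The estimate is invariant under affine changes of variable, so the optimal constant for a
   single cell is the optimal constant for all intervals. *)

definition C_opt :: "nat \<Rightarrow> real" where
  "C_opt k = Inf {C. C > 0 \<and> (\<forall>a b p. a < b \<longrightarrow> degree p \<le> k \<longrightarrow>
     L4_norm_on a b (poly p) \<le> sqrt C * (b - a) powr (- 1 / 4) * L2_norm_on a b (poly p))}"

definition beta_admissible :: "nat \<Rightarrow> real \<Rightarrow> bool" where
  "beta_admissible k \<beta> \<longleftrightarrow>
     (\<forall>U a b p. C_diff 3 U \<longrightarrow> a < b \<longrightarrow> degree p \<le> k \<longrightarrow>
       (let R = \<beta> / (2 * (b - a)) * (SUP y\<in>{a..b}. \<bar>(deriv ^^ 3) U (poly p y)\<bar>)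
                * integral {a..b} (\<lambda>y. \<bar>poly p y - cell_avg a b (poly p)\<bar>\<^sup>2)
        in \<bar>poly (l2_proj k a b (\<lambda>y. deriv U (poly p y) - deriv U (poly p a))) a\<bar> \<le> R \<and>
           \<bar>poly (l2_proj k a b (\<lambda>y. deriv U (poly p y) - deriv U (poly p b))) b\<bar> \<le> R))"

definition flux_at ::
  "nat \<Rightarrow> (nat \<Rightarrow> real) \<Rightarrow> (real \<Rightarrow> real \<Rightarrow> real) \<Rightarrow> real \<Rightarrow> real \<Rightarrow> (nat \<Rightarrow> real poly) \<Rightarrow> nat \<Rightarrow> real"
  where
  "flux_at N x fh gl gr u j = fh (trace_minus x gl u j) (trace_plus N x gr u j)"

(* B_j[u;U]; Hp and Hm are H^+_{j-1/2} and H^-_{j+1/2}. Since f o p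
   is differentiable on the whole line for a polynomial p, its derivative on the closed cell
   is the continuous extension of the interior one. *)

definition damping ::
  "nat \<Rightarrow> nat \<Rightarrow> (nat \<Rightarrow> real) \<Rightarrow> (real \<Rightarrow> real) \<Rightarrow> (real \<Rightarrow> real \<Rightarrow> real) \<Rightarrow> real \<Rightarrow>
   real \<Rightarrow> real \<Rightarrow> (nat \<Rightarrow> real poly) \<Rightarrow> (real \<Rightarrow> real) \<Rightarrow> nat \<Rightarrow> real" where
  "damping k N x f fh \<beta> gl gr u U j =
     (let a = x (j - 1); b = x j; h = b - a; p = u j;
          fx = deriv (\<lambda>y. f (poly p y));
          Hp = flux_at N x fh gl gr u (j - 1) - f (trace_plus N x gr u (j - 1));
          Hm = - flux_at N x fh gl gr u j + f (trace_minus x gl u j)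
      in (SUP y\<in>cell x j. \<bar>(deriv ^^ 3) U (poly p y)\<bar>)
           / (INF y\<in>cell x j. \<bar>(deriv ^^ 2) U (poly p y)\<bar>)
         * (C_opt k / (2 * sqrt h) * L2_norm_on a b (\<lambda>y. fx y - poly (l2_proj k a b fx) y)
            + \<beta> / (2 * h) * (\<bar>Hp\<bar> + \<bar>Hm\<bar>)))"

(* u solves Scheme B on the time interval T. The exterior traces gl, gr may depend on time in an
   arbitrary way, in particular through u (e.g. periodic boundary conditions). *)

definition scheme_B ::
  "nat \<Rightarrow> nat \<Rightarrow> (nat \<Rightarrow> real) \<Rightarrow> (real \<Rightarrow> real) \<Rightarrow> (real \<Rightarrow> real \<Rightarrow> real) \<Rightarrow> real \<Rightarrow> (real \<Rightarrow> real) \<Rightarrow>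
   (real \<Rightarrow> real) \<Rightarrow> (real \<Rightarrow> real) \<Rightarrow> real set \<Rightarrow> (real \<Rightarrow> nat \<Rightarrow> real poly) \<Rightarrow> bool" where
  "scheme_B k N x f fh \<beta> U gl gr T u \<longleftrightarrow>
     (\<forall>t\<in>T. u t \<in> Vk k N \<and>
       (\<forall>j\<in>{1..N}.
         (\<forall>y\<in>cell x j. (\<lambda>s. poly (u s j) y) differentiable (at t within T)) \<and>
         (\<forall>v\<in>Vk k N.
            integral (cell x j)
              (\<lambda>y. vector_derivative (\<lambda>s. poly (u s j) y) (at t within T) * poly (v j) y)
            - integral (cell x j) (\<lambda>y. f (poly (u t j) y) * poly (pderiv (v j)) y)
            + flux_at N x fh (gl t) (gr t) (u t) j * poly (v j) (x j)
            - flux_at N x fh (gl t) (gr t) (u t) (j - 1) * poly (v j) (x (j - 1))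
            = - damping k N x f fh \<beta> (gl t) (gr t) (u t) U j
              * integral (cell x j)
                  (\<lambda>y. (poly (u t j) y - cell_avg (x (j - 1)) (x j) (poly (u t j))) * poly (v j) y))))"

definition entropy_potential ::
  "(real \<Rightarrow> real) \<Rightarrow> (real \<Rightarrow> real) \<Rightarrow> (real \<Rightarrow> real) \<Rightarrow> real \<Rightarrow> real" where
  "entropy_potential U f \<F> w = deriv U w * f w - \<F> w"

definition num_entropy_flux ::
  "(real \<Rightarrow> real) \<Rightarrow> (real \<Rightarrow> real) \<Rightarrow> (real \<Rightarrow> real) \<Rightarrow> (real \<Rightarrow> real \<Rightarrow> real) \<Rightarrow> real \<Rightarrow> real \<Rightarrow> real" where
  "num_entropy_flux U f \<F> fh a b = deriv U a * fh a b - entropy_potential U f \<F> a"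

end

theory Submission
  imports Defs
begin

text \<open>
  Fix a cell $[a,b]$ of length $h$, write $p$ for the cell polynomial, $e = p - \overline p$ for its
  deviation from the cell average, $E = \int e^2$ and $w = U'(p)$ for the entropy variable.
  Since $p_t$ has degree at most $k$, the rate of change of the entropy is
  $\int w\,p_t = \int \pi[w]\,p_t$, and $v = \pi[w]$ is an admissible test function. With $v = w$
  an exact entropy balance would come out of the scheme; the projection destroys it by two kinds of
  error, and the damping coefficient is designed to dominate both.

  \<^item> Integration by parts leaves $\int f(p)_x v$ in place of
    $\int f(p)_x w = \mathcal F(p(b)) - \mathcal F(p(a))$. The difference is the integral of
    $(f(p)_x - \pi[f(p)_x])\,w$. The first factor is orthogonal to all polynomials of degree at
    most $k$, so the linear Taylor polynomial of $U'$ at the average, which is affine in $p$, may be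
    subtracted from $w$. What remains is at most $\frac12\max|U'''|\,e^2$, and Cauchy-Schwarz
    followed by the $L^4$-$L^2$ inequality bounds the error by a multiple of $E$
    (lemma \<open>projection_residual_pairing_bound\<close>).

  \<^item> At the two end-points the fluxes multiply $v$ instead of $w$; there $v - w$ is
    the projection of $w - w(a)$ or $w - w(b)$, which \<open>beta_admissible\<close> bounds by a
    multiple of $E$.

  On the other side, the damping term tests $e$ against $w$, and monotonicity of $U'$ gives
  $\int e\,w \ge \min U''\cdot E$ (lemma \<open>monotone_pairing_lower_bound\<close>). The quotient
  of maximum and minimum in $B_j$ makes this cancel the bounds for the two errors exactly. The result is
  \<open>cell_entropy_inequality\<close>, in which both interface terms are formed with the traces
  from inside the cell. At the right end-point this already is the numerical entropy flux; at the
  left one, replacing the inner by the outer trace changes the term by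
  $\int U''(s)\,(\hat f - f(s))\,ds$, whose sign is the E-flux condition
  (lemma \<open>E_flux_entropy_jump\<close>).

  Three analytic facts support this. The projection exists and the optimal constant is taken over a
  nonempty set because the polynomials of degree at most $k$ have an orthonormal basis. The $L^4$-$L^2$
  inequality holds with the infimum itself because it is a closed condition on the constant. Finally, the scheme only
  provides pointwise time derivatives of the cell polynomial; Lagrange interpolation
  turns them into derivatives of finitely many coefficients, after which the
  entropy integral can be differentiated (lemma \<open>time_derivative_of_cell_polynomial\<close>).
\<close>

section \<open>Calculus on an interval\<close>

lemma continuous_on_Icc_bounded:
  fixes g :: "real \<Rightarrow> real"
  assumes "continuous_on {a..b} g"
  obtains M where "\<And>y. y \<in> {a..b} \<Longrightarrow> \<bar>g y\<bar> \<le> M"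
proof -
  have "bounded (g ` {a..b})"
    by (intro compact_imp_bounded compact_continuous_image assms compact_Icc)
  then show thesis using that by (metis bounded_iff image_eqI real_norm_def)
qed

lemma continuous_on_DERIV_comp:
  fixes g h :: "real \<Rightarrow> real"
  assumes "\<And>w. (g has_real_derivative g' w) (at w)" "continuous_on S h"
  shows "continuous_on S (\<lambda>y. g (h y))"
proof -
  have "continuous_on UNIV g"
    using assms(1) by (meson DERIV_continuous_on DERIV_subset subset_UNIV)
  then show ?thesis using assms(2) by (rule continuous_on_compose2) simp
qed

text \<open>
  The sharp factor $1/2$ is the one that appears in the damping coefficient, so a Taylor bound
  with a lossy constant would not do.
\<close>

lemma Taylor_remainder_2:
  fixes g g' g'' :: "real \<Rightarrow> real"
  assumes "\<And>w. (g has_real_derivative g' w) (at w)" "\<And>w. (g' has_real_derivative g'' w) (at w)"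
    and "\<And>\<xi>. \<xi> \<in> {min z w..max z w} \<Longrightarrow> \<bar>g'' \<xi>\<bar> \<le> M"
  shows "\<bar>g w - g z - g' z * (w - z)\<bar> \<le> M / 2 * (w - z)\<^sup>2"
proof (cases "w = z")
  case False
  let ?d = "\<lambda>m::nat. if m = 0 then g else if m = 1 then g' else g''"
  have "\<exists>\<xi>. (if w < z then w < \<xi> \<and> \<xi> < z else z < \<xi> \<and> \<xi> < w) \<and>
    g w = (\<Sum>m<2. ?d m z / fact m * (w - z) ^ m) + ?d 2 \<xi> / fact 2 * (w - z)\<^sup>2"
    using assms False
    by (intro Taylor[where a = "min z w" and b = "max z w"]) (auto simp: less_Suc_eq numeral_2_eq_2)
  then obtain \<xi> where between: "if w < z then w < \<xi> \<and> \<xi> < z else z < \<xi> \<and> \<xi> < w"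
    and "g w = (\<Sum>m<2. ?d m z / fact m * (w - z) ^ m) + ?d 2 \<xi> / fact 2 * (w - z)\<^sup>2"
    by blast
  then have eq: "g w = g z + g' z * (w - z) + g'' \<xi> / 2 * (w - z)\<^sup>2"
    by (simp add: numeral_2_eq_2)
  have \<xi>: "\<xi> \<in> {min z w..max z w}" using between by (auto split: if_splits)
  have "\<bar>g w - g z - g' z * (w - z)\<bar> = \<bar>g'' \<xi>\<bar> / 2 * (w - z)\<^sup>2"
    by (simp add: eq abs_mult)
  also have "\<dots> \<le> M / 2 * (w - z)\<^sup>2"
    using assms(3)[OF \<xi>] by (intro mult_right_mono) auto
  finally show ?thesis .
qed simp

lemma C_diff_DERIV:
  assumes "C_diff n g" "m < n"
  shows "((deriv ^^ m) g has_real_derivative (deriv ^^ Suc m) g y) (at y)"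
  using assms by (simp add: C_diff_def DERIV_deriv_iff_real_differentiable)

text \<open>
  The form $\int (s g - q r)^2$ is nonnegative in both $s$ and $q$, so its discriminant has a sign.
\<close>

lemma Cauchy_Schwarz_integral:
  fixes g r :: "real \<Rightarrow> real"
  assumes g: "continuous_on {a..b} g" and r: "continuous_on {a..b} r"
  shows "\<bar>integral {a..b} (\<lambda>y. g y * r y)\<bar> \<le> sqrt (integral {a..b} (\<lambda>y. (g y)\<^sup>2)) * sqrt (integral {a..b} (\<lambda>y. (r y)\<^sup>2))"
proof -
  \<comment> \<open>The quadratic form has matrix entries \<open>A\<close>, \<open>- B\<close>, \<open>C\<close>.\<close>
  define A B C where "A = integral {a..b} (\<lambda>y. (g y)\<^sup>2)"
    and "B = integral {a..b} (\<lambda>y. g y * r y)" and "C = integral {a..b} (\<lambda>y. (r y)\<^sup>2)"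
  have quad: "0 \<le> A * s\<^sup>2 - 2 * s * q * B + C * q\<^sup>2" for s q
  proof -
    have "0 \<le> integral {a..b} (\<lambda>y. (s * g y - q * r y)\<^sup>2)"
      using g r by (intro integral_nonneg) (auto intro!: integrable_continuous_interval continuous_intros)
    also have "\<dots> = integral {a..b} (\<lambda>y. (s\<^sup>2 * (g y)\<^sup>2 - 2 * s * q * (g y * r y)) + q\<^sup>2 * (r y)\<^sup>2)"
      by (rule integral_cong) (simp add: power2_eq_square algebra_simps)
    also have "\<dots> = (s\<^sup>2 * A - 2 * s * q * B) + q\<^sup>2 * C"
      unfolding A_def B_def C_def using g r
      by (subst integral_add integral_diff; (subst integral_diff)?)
        (auto intro!: integrable_continuous_interval continuous_intros)
    finally show ?thesis by (simp add: algebra_simps)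
  qed
  have "A \<ge> 0" "C \<ge> 0" using quad[of 1 0] quad[of 0 1] by auto
  have "B\<^sup>2 \<le> A * C"
  proof (cases "C = 0")
    case False
    then have "0 \<le> C * (A * C - B\<^sup>2)"
      using quad[of C B] by (simp add: power2_eq_square algebra_simps)
    with False \<open>C \<ge> 0\<close> show ?thesis by (simp add: zero_le_mult_iff)
  next
    case True
    have "B = 0"
    proof (rule ccontr)
      assume "B \<noteq> 0"
      \<comment> \<open>With \<open>C = 0\<close> the form is affine in \<open>q\<close>; this choice gives it the value \<open>-1\<close>.\<close>
      then show False using quad[of 1 "(A + 1) / (2 * B)"] True \<open>A \<ge> 0\<close> by simp
    qed
    with True show ?thesis by simp
  qed
  then have "sqrt (B\<^sup>2) \<le> sqrt (A * C)" by (rule real_sqrt_le_mono)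
  then show ?thesis by (simp add: A_def B_def C_def real_sqrt_mult)
qed

section \<open>The projection onto polynomials\<close>

lemma integral_square_pos:
  fixes p :: "real poly"
  assumes "a < b" "p \<noteq> 0"
  shows "0 < integral {a..b} (\<lambda>y. poly p y * poly p y)"
proof -
  have "integral {a..b} (\<lambda>y. poly p y * poly p y) \<noteq> 0"
  proof
    assume "integral {a..b} (\<lambda>y. poly p y * poly p y) = 0"
    then have "\<forall>y\<in>{a..b}. poly p y * poly p y = 0"
      using assms(1) by (subst (asm) integral_eq_0_iff) (auto intro!: integrable_continuous_interval continuous_intros)
    then have "{a..b} \<subseteq> {y. poly p y = 0}" by auto
    with poly_roots_finite[OF assms(2)] infinite_Icc[OF assms(1)] show False
      using finite_subset by blast
  qed
  moreover have "0 \<le> integral {a..b} (\<lambda>y. poly p y * poly p y)"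
    by (intro integral_nonneg) (auto intro!: integrable_continuous_interval continuous_intros)
  ultimately show ?thesis by linarith
qed

text \<open>
  The coefficients $\int p\,e_i$ reproduce $v$, hence the same formula applied to any
  continuous $g$ yields a function with the same inner product with $v$: both
  sides are the symmetric bilinear expression $\sum_i \int g e_i \int v e_i$. This turns a
  reproducing system into an orthogonal projection.
\<close>

lemma reproducing_integral:
  fixes e :: "nat \<Rightarrow> real poly" and g :: "real \<Rightarrow> real"
  assumes g: "continuous_on {a..b} g"
    and v: "v = (\<Sum>i<n. smult (integral {a..b} (\<lambda>y. poly v y * poly (e i) y)) (e i))"
  shows "integral {a..b} (\<lambda>y. (g y - poly (\<Sum>i<n. smult (integral {a..b} (\<lambda>y. g y * poly (e i) y)) (e i)) y) * poly v y) = 0"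
proof -
  let ?ip = "\<lambda>r s. integral {a..b} (\<lambda>y. r y * s y :: real)"
  have "?ip g (poly v) = ?ip g (\<lambda>y. \<Sum>i<n. ?ip (poly v) (poly (e i)) * poly (e i) y)"
    by (subst v) (simp add: poly_sum)
  also have "\<dots> = (\<Sum>i<n. ?ip (poly v) (poly (e i)) * ?ip g (poly (e i)))"
  proof -
    have "?ip g (\<lambda>y. \<Sum>i<n. ?ip (poly v) (poly (e i)) * poly (e i) y)
        = integral {a..b} (\<lambda>y. \<Sum>i<n. ?ip (poly v) (poly (e i)) * (g y * poly (e i) y))"
      by (simp add: sum_distrib_left algebra_simps)
    also have "\<dots> = (\<Sum>i<n. integral {a..b} (\<lambda>y. ?ip (poly v) (poly (e i)) * (g y * poly (e i) y)))"
      using g by (intro integral_sum) (auto intro!: integrable_continuous_interval continuous_intros)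
    finally show ?thesis by simp
  qed
  finally have 1: "?ip g (poly v) = \<dots>" .
  have "?ip (\<lambda>y. \<Sum>i<n. ?ip g (poly (e i)) * poly (e i) y) (poly v)
      = (\<Sum>i<n. ?ip g (poly (e i)) * ?ip (poly v) (poly (e i)))"
    by (simp add: sum_distrib_right mult.assoc, subst integral_sum)
      (auto intro!: integrable_continuous_interval continuous_intros simp: mult.commute)
  with 1 show ?thesis using g
    by (simp add: poly_sum left_diff_distrib, subst integral_diff)
       (auto intro!: integrable_continuous_interval continuous_intros simp: mult.commute)
qed

text \<open>
  Gram-Schmidt, with the reproducing identity in place of orthonormality as induction hypothesis:
  it makes the remainder of the next monomial orthogonal to the space constructed so far, by
  \<open>reproducing_integral\<close>. Degree below $n$ is expressed by vanishing coefficients so that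
  $n = 0$ means the zero space, which gives a trivial base case.
\<close>

lemma reproducing_system_exists:
  fixes a b :: real
  assumes "a < b"
  shows "\<exists>e :: nat \<Rightarrow> real poly. (\<forall>i<n. \<forall>m\<ge>n. coeff (e i) m = 0) \<and>
    (\<forall>p. (\<forall>m\<ge>n. coeff p m = 0) \<longrightarrow>
       p = (\<Sum>i<n. smult (integral {a..b} (\<lambda>y. poly p y * poly (e i) y)) (e i)))"
proof (induction n)
  case 0
  then show ?case by (auto simp: poly_eq_iff)
next
  case (Suc n)
  let ?ip = "\<lambda>r s. integral {a..b} (\<lambda>y. poly r y * poly s y :: real)"
  obtain e :: "nat \<Rightarrow> real poly" where e: "\<And>i m. i < n \<Longrightarrow> m \<ge> n \<Longrightarrow> coeff (e i) m = 0"
    and rep: "\<And>p. (\<And>m. m \<ge> n \<Longrightarrow> coeff p m = 0) \<Longrightarrow> p = (\<Sum>i<n. smult (?ip p (e i)) (e i))"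
    using Suc by blast
  define m where "m = monom 1 n - (\<Sum>i<n. smult (?ip (monom 1 n) (e i)) (e i))"
  have mn: "coeff m n = 1" and mhigh: "\<And>l. l > n \<Longrightarrow> coeff m l = 0"
    by (auto simp: m_def coeff_sum e)
  have orth: "?ip m v = 0" if "\<And>l. l \<ge> n \<Longrightarrow> coeff v l = 0" for v
    using reproducing_integral[OF _ rep[OF that], of "poly (monom 1 n)"]
    by (simp add: m_def continuous_intros)
  have "m \<noteq> 0" using mn by auto
  then have pos: "0 < ?ip m m" using integral_square_pos assms by blast
  define c where "c = ?ip m m"
  have "c > 0" using pos by (simp only: c_def)
  define e' where "e' = e(n := smult (1 / sqrt c) m)"
  have "p = (\<Sum>i<Suc n. smult (?ip p (e' i)) (e' i))"
    if p: "\<And>l. l \<ge> Suc n \<Longrightarrow> coeff p l = 0" for p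
  proof -
    \<comment> \<open>\<open>m\<close> is monic of degree \<open>n\<close>, so this removes the leading term.\<close>
    define r where "r = p - smult (coeff p n) m"
    have r: "coeff r l = 0" if "l \<ge> n" for l
      using that by (cases "l = n") (auto simp: r_def mn mhigh p)
    have ipp: "?ip p s = ?ip r s + coeff p n * ?ip m s" for s
    proof -
      have "?ip p s = integral {a..b} (\<lambda>y. poly r y * poly s y + coeff p n * (poly m y * poly s y))"
        by (simp add: r_def algebra_simps)
      also have "\<dots> = ?ip r s + coeff p n * ?ip m s"
        by (subst integral_add) (auto intro!: integrable_continuous_interval continuous_intros)
      finally show ?thesis .
    qed
    have low: "?ip p (e i) = ?ip r (e i)" if "i < n" for i
      using orth[of "e i"] e that by (simp add: ipp)
    have "?ip r m = 0" using orth[OF r] by (simp add: mult.commute)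
    then have "?ip p m = coeff p n * c" by (simp add: ipp c_def)
    then have "?ip p (e' n) = coeff p n * c / sqrt c" by (simp add: e'_def)
    also have "\<dots> = coeff p n * sqrt c"
      using \<open>c > 0\<close> real_div_sqrt[of c] by (simp only: times_divide_eq_right[symmetric])
    finally have "?ip p (e' n) = coeff p n * sqrt c" .
    then have "smult (?ip p (e' n)) (e' n) = smult (coeff p n * sqrt c) (e' n)" by (rule arg_cong)
    also have "\<dots> = smult (coeff p n) m" using \<open>c > 0\<close> by (simp add: e'_def)
    finally have top: "smult (?ip p (e' n)) (e' n) = smult (coeff p n) m" .
    have "(\<Sum>i<n. smult (?ip p (e' i)) (e' i)) = (\<Sum>i<n. smult (?ip r (e i)) (e i))"
      by (rule sum.cong) (auto simp: e'_def low)
    also have "\<dots> = r" using rep[OF r] by simp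
    finally show ?thesis using top by (simp add: r_def)
  qed
  moreover have "coeff (e' i) l = 0" if "i < Suc n" "l \<ge> Suc n" for i l
    using that e mhigh by (auto simp: e'_def)
  ultimately show ?case by blast
qed

lemma reproducing_basis_exists:
  fixes a b :: real
  assumes "a < b"
  obtains e :: "nat \<Rightarrow> real poly" where "\<And>i. i < Suc k \<Longrightarrow> degree (e i) \<le> k"
    and "\<And>p. degree p \<le> k \<Longrightarrow>
       p = (\<Sum>i<Suc k. smult (integral {a..b} (\<lambda>y. poly p y * poly (e i) y)) (e i))"
proof -
  obtain e :: "nat \<Rightarrow> real poly" where
    e: "\<And>i m. i < Suc k \<Longrightarrow> m \<ge> Suc k \<Longrightarrow> coeff (e i) m = 0" and
    rep: "\<And>p. (\<And>m. m \<ge> Suc k \<Longrightarrow> coeff p m = 0) \<Longrightarrow>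
       p = (\<Sum>i<Suc k. smult (integral {a..b} (\<lambda>y. poly p y * poly (e i) y)) (e i))"
    using reproducing_system_exists[OF assms, of "Suc k"] by blast
  show thesis
  proof (rule that)
    show "degree (e i) \<le> k" if "i < Suc k" for i
      using that e by (intro degree_le) auto
    show "p = (\<Sum>i<Suc k. smult (integral {a..b} (\<lambda>y. poly p y * poly (e i) y)) (e i))"
      if "degree p \<le> k" for p
      using that by (intro rep) (auto intro!: coeff_eq_0)
  qed
qed

text \<open>
  The definition of the projection is a definite description; here it is justified, so that
  afterwards only orthogonality of the residual and uniqueness matter. Two candidates differ by a
  polynomial that is orthogonal to itself.
\<close>

lemma l2_proj_characterization:
  fixes g :: "real \<Rightarrow> real"
  assumes "a < b" and g: "continuous_on {a..b} g"
  shows "degree (l2_proj k a b g) \<le> k"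
    and "\<And>v. degree v \<le> k \<Longrightarrow> integral {a..b} (\<lambda>y. (g y - poly (l2_proj k a b g) y) * poly v y) = 0"
    and "\<And>q. degree q \<le> k \<Longrightarrow>
      (\<And>v. degree v \<le> k \<Longrightarrow> integral {a..b} (\<lambda>y. (g y - poly q y) * poly v y) = 0) \<Longrightarrow>
      l2_proj k a b g = q"
proof -
  let ?P = "\<lambda>q. degree q \<le> k \<and>
     (\<forall>v. degree v \<le> k \<longrightarrow> integral {a..b} (\<lambda>y. (g y - poly q y) * poly v y) = 0)"
  have "\<exists>q. ?P q"
  proof -
    obtain e :: "nat \<Rightarrow> real poly" where e: "\<And>i. i < Suc k \<Longrightarrow> degree (e i) \<le> k"
      and rep: "\<And>p. degree p \<le> k \<Longrightarrow>
       p = (\<Sum>i<Suc k. smult (integral {a..b} (\<lambda>y. poly p y * poly (e i) y)) (e i))"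
      using reproducing_basis_exists[OF assms(1)] by metis
    let ?q = "\<Sum>i<Suc k. smult (integral {a..b} (\<lambda>y. g y * poly (e i) y)) (e i)"
    have "degree ?q \<le> k"
      using e by (intro degree_sum_le) (auto intro: order.trans[OF degree_smult_le])
    then have "?P ?q"
      using reproducing_integral[OF g rep] by blast
    then show ?thesis by blast
  qed
  moreover have uniq: "q = r" if q: "?P q" and r: "?P r" for q r
  proof (rule ccontr)
    assume "q \<noteq> r"
    let ?d = "q - r"
    have d: "degree ?d \<le> k" using q r by (intro degree_diff_le) auto
    have "integral {a..b} (\<lambda>y. poly ?d y * poly ?d y) =
      integral {a..b} (\<lambda>y. (g y - poly r y) * poly ?d y - (g y - poly q y) * poly ?d y)"
      by (simp add: algebra_simps)
    also have "\<dots> = integral {a..b} (\<lambda>y. (g y - poly r y) * poly ?d y)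
        - integral {a..b} (\<lambda>y. (g y - poly q y) * poly ?d y)"
      using g by (intro integral_diff) (auto intro!: integrable_continuous_interval continuous_intros)
    also have "\<dots> = 0"
      using conjunct2[OF q, rule_format, OF d] conjunct2[OF r, rule_format, OF d] by (simp only: diff_self)
    finally show False using integral_square_pos[OF assms(1), of ?d] \<open>q \<noteq> r\<close> by simp
  qed
  ultimately have ex1: "\<exists>!q. ?P q" by blast
  have P: "?P (l2_proj k a b g)" unfolding l2_proj_def by (rule theI'[OF ex1])
  show "degree (l2_proj k a b g) \<le> k" using P by blast
  show "\<And>v. degree v \<le> k \<Longrightarrow> integral {a..b} (\<lambda>y. (g y - poly (l2_proj k a b g) y) * poly v y) = 0"
    using P by blast
  show "l2_proj k a b g = q" if "degree q \<le> k"
    "\<And>v. degree v \<le> k \<Longrightarrow> integral {a..b} (\<lambda>y. (g y - poly q y) * poly v y) = 0" for q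
    using uniq[OF P] that by blast
qed

lemma l2_proj_diff_const:
  fixes g :: "real \<Rightarrow> real"
  assumes "a < b" and g: "continuous_on {a..b} g"
  shows "l2_proj k a b (\<lambda>y. g y - c) = l2_proj k a b g - [:c:]"
proof (rule l2_proj_characterization(3))
  show "degree (l2_proj k a b g - [:c:]) \<le> k"
    using l2_proj_characterization(1)[OF assms] by (intro degree_diff_le) auto
  show "integral {a..b} (\<lambda>y. (g y - c - poly (l2_proj k a b g - [:c:]) y) * poly v y) = 0"
    if "degree v \<le> k" for v
    using l2_proj_characterization(2)[OF assms that] by simp
qed (use assms in \<open>auto intro!: continuous_intros\<close>)

section \<open>The optimal constant between the norms\<close>

text \<open>
  Fourth powers remove the roots from the inequality that defines \<open>C_opt\<close>.
\<close>

lemma L4_norm_le_iff: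
  assumes "a < b" "C > 0"
  shows "L4_norm_on a b (poly p) \<le> sqrt C * (b - a) powr (- 1 / 4) * L2_norm_on a b (poly p) \<longleftrightarrow>
    integral {a..b} (\<lambda>y. (poly p y) ^ 4) \<le> C\<^sup>2 / (b - a) * (integral {a..b} (\<lambda>y. (poly p y)\<^sup>2))\<^sup>2"
proof -
  let ?J4 = "integral {a..b} (\<lambda>y. (poly p y) ^ 4)" and ?J2 = "integral {a..b} (\<lambda>y. (poly p y)\<^sup>2)"
  have J: "?J4 \<ge> 0" "?J2 \<ge> 0"
    by (auto intro!: integral_nonneg integrable_continuous_interval continuous_intros)
  let ?R = "sqrt C * (b - a) powr (- 1 / 4) * sqrt ?J2"
  have sq: "sqrt z ^ 4 = z\<^sup>2" if "z \<ge> 0" for z :: real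
    using power_mult[of "sqrt z" 2 2] that by simp
  have "((b - a) powr (- 1 / 4)) ^ 4 = (b - a) powr (- 1)"
    using assms(1) by (simp add: powr_power)
  then have R4: "?R ^ 4 = C\<^sup>2 / (b - a) * ?J2\<^sup>2"
    using assms J by (simp only: power_mult_distrib sq) (simp add: powr_minus_divide)
  have "?R \<ge> 0" using assms J by simp
  then have "root 4 ?J4 \<le> ?R \<longleftrightarrow> root 4 ?J4 ^ 4 \<le> ?R ^ 4"
    using J power_mono_iff[of "root 4 ?J4" ?R 4] by simp
  also have "root 4 ?J4 ^ 4 = ?J4" using J by simp
  finally show ?thesis unfolding R4 L4_norm_on_def L2_norm_on_def .
qed

text \<open>
  Expanding in an orthonormal basis bounds the supremum of $|p|$ by $S\,\|p\|_{L^2}$;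
  then $\int p^4 \le \sup p^2 \int p^2$.
\<close>

lemma L4_L2_bound_unit_interval:
  obtains K where "K > 0"
    and "\<And>p :: real poly. degree p \<le> k \<Longrightarrow>
      integral {0..1} (\<lambda>y. (poly p y) ^ 4) \<le> K * (integral {0..1} (\<lambda>y. (poly p y)\<^sup>2))\<^sup>2"
proof -
  obtain e :: "nat \<Rightarrow> real poly" where
    rep: "\<And>p. degree p \<le> k \<Longrightarrow>
       p = (\<Sum>i<Suc k. smult (integral {0..1} (\<lambda>y. poly p y * poly (e i) y)) (e i))"
    using reproducing_basis_exists[of 0 1 k] zero_less_one by metis
  have "\<exists>M. \<forall>y\<in>{0..1}. \<bar>poly (e i) y\<bar> \<le> M" for i
  proof -
    have "continuous_on {0..1} (poly (e i))" by (intro continuous_intros)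
    then show ?thesis by (rule continuous_on_Icc_bounded) blast
  qed
  then obtain M where M: "\<And>i y. y \<in> {0..1} \<Longrightarrow> \<bar>poly (e i) y\<bar> \<le> M i" by metis
  let ?n = "\<lambda>p. sqrt (integral {0..1} (\<lambda>y. (poly p y)\<^sup>2))"
  \<comment> \<open>The summand 1 makes the constant positive, as the definition of \<open>C_opt\<close> demands.\<close>
  define S where "S = 1 + (\<Sum>i<Suc k. ?n (e i) * M i)"
  have M0: "M i \<ge> 0" for i using M[of 0 i] by auto
  have nn: "integral {0..1} (\<lambda>y. (poly p y)\<^sup>2) \<ge> 0" for p :: "real poly"
    by (auto intro!: integral_nonneg integrable_continuous_interval continuous_intros)
  have S: "S > 0" unfolding S_def using M0 nn
    by (intro add_pos_nonneg sum_nonneg mult_nonneg_nonneg) auto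
  have sup: "\<bar>poly p y\<bar> \<le> S * ?n p" if "degree p \<le> k" "y \<in> {0..1}" for p :: "real poly" and y
  proof -
    have "\<bar>poly p y\<bar> = \<bar>\<Sum>i<Suc k. integral {0..1} (\<lambda>y. poly p y * poly (e i) y) * poly (e i) y\<bar>"
      by (subst (1) rep[OF that(1)]) (simp add: poly_sum)
    also have "\<dots> \<le> (\<Sum>i<Suc k. ?n p * ?n (e i) * M i)"
      unfolding abs_mult using M[OF that(2)] nn
      by (intro order.trans[OF sum_abs] sum_mono)
        (auto simp: abs_mult intro!: mult_mono Cauchy_Schwarz_integral continuous_intros)
    also have "\<dots> = (S - 1) * ?n p" by (simp add: S_def sum_distrib_left sum_distrib_right algebra_simps)
    also have "\<dots> \<le> S * ?n p" using nn by (intro mult_right_mono) auto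
    finally show ?thesis .
  qed
  show thesis
  proof (rule that)
    show "S\<^sup>2 > 0" using S by simp
    fix p :: "real poly" assume p: "degree p \<le> k"
    have "(poly p y)\<^sup>2 \<le> S\<^sup>2 * (?n p)\<^sup>2" if "y \<in> {0..1}" for y
      using power_mono[OF sup[OF p that], of 2] by (simp add: power_mult_distrib)
    then have "(poly p y) ^ 4 \<le> S\<^sup>2 * (?n p)\<^sup>2 * (poly p y)\<^sup>2" if "y \<in> {0..1}" for y
      using mult_right_mono[of "(poly p y)\<^sup>2" "S\<^sup>2 * (?n p)\<^sup>2" "(poly p y)\<^sup>2"] that
      by (simp only: power_add[symmetric] zero_le_power2) simp
    then have "integral {0..1} (\<lambda>y. (poly p y) ^ 4) \<le> integral {0..1} (\<lambda>y. S\<^sup>2 * (?n p)\<^sup>2 * (poly p y)\<^sup>2)"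
      by (intro integral_le integrable_continuous_interval continuous_intros) blast
    also have "\<dots> = S\<^sup>2 * (integral {0..1} (\<lambda>y. (poly p y)\<^sup>2))\<^sup>2"
      using nn[of p] by (simp add: power2_eq_square)
    finally show "integral {0..1} (\<lambda>y. (poly p y) ^ 4) \<le> S\<^sup>2 * (integral {0..1} (\<lambda>y. (poly p y)\<^sup>2))\<^sup>2" .
  qed
qed

text \<open>
  A constant valid on all intervals is obtained from the unit interval by an affine change of
  variable, which produces the factor $1/h$.
\<close>

lemma L4_L2_bound:
  obtains K where "K > 0"
    and "\<And>a b (p :: real poly). a < b \<Longrightarrow> degree p \<le> k \<Longrightarrow>
      integral {a..b} (\<lambda>y. (poly p y) ^ 4) \<le> K / (b - a) * (integral {a..b} (\<lambda>y. (poly p y)\<^sup>2))\<^sup>2"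
proof -
  obtain K where "K > 0" and K: "\<And>p :: real poly. degree p \<le> k \<Longrightarrow>
      integral {0..1} (\<lambda>y. (poly p y) ^ 4) \<le> K * (integral {0..1} (\<lambda>y. (poly p y)\<^sup>2))\<^sup>2"
    using L4_L2_bound_unit_interval by metis
  show thesis
  proof (rule that[OF \<open>K > 0\<close>])
    fix a b :: real and p :: "real poly"
    assume ab: "a < b" and p: "degree p \<le> k"
    define q where "q = pcompose p [:a, b - a:]"
    have "degree q \<le> k" using p ab by (simp add: q_def degree_pcompose)
    have img: "(\<lambda>x. x / (b - a) - a / (b - a)) ` {a..b} = {0..1}"
      using ab image_affinity_atLeastAtMost[of "1 / (b - a)" "- a / (b - a)" a b]
      by (simp add: diff_divide_distrib[symmetric])
    have "integral {0..1} (\<lambda>y. (poly q y) ^ m) = integral {a..b} (\<lambda>y. (poly p y) ^ m) / (b - a)" for m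
    proof (rule integral_unique)
      have "((\<lambda>y. poly p y ^ m) has_integral integral {a..b} (\<lambda>y. poly p y ^ m)) (cbox a b)"
        by (auto intro!: integrable_integral integrable_continuous_interval continuous_intros)
      from has_integral_affinity[OF this, of "b - a" a] ab img
      show "((\<lambda>y. poly q y ^ m) has_integral integral {a..b} (\<lambda>y. poly p y ^ m) / (b - a)) {0..1}"
        by (simp add: q_def poly_pcompose algebra_simps)
    qed
    with K[OF \<open>degree q \<le> k\<close>] ab
    show "integral {a..b} (\<lambda>y. (poly p y) ^ 4) \<le> K / (b - a) * (integral {a..b} (\<lambda>y. (poly p y)\<^sup>2))\<^sup>2"
      by (simp add: power_divide power2_eq_square[of "b - a"] divide_simps) (simp add: mult_ac)?
  qed
qed

text \<open>
  The infimum is attained: every admissible $C$ satisfies $\sqrt h\,\|p\|_{L^4}^2 \le C \|p\|_{L^2}^2$,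
  and one may divide by the norm on the right and pass to the infimum. This needs an
  admissible $C$ to exist, as the infimum of the empty set is unspecified.
\<close>

lemma C_opt_bound:
  assumes ab: "a < b" and p: "degree p \<le> k"
  shows "sqrt (integral {a..b} (\<lambda>y. (poly p y) ^ 4))
    \<le> C_opt k / sqrt (b - a) * integral {a..b} (\<lambda>y. (poly p y)\<^sup>2)"
proof -
  define S where "S = {C. C > 0 \<and> (\<forall>a b p. a < b \<longrightarrow> degree p \<le> k \<longrightarrow>
     L4_norm_on a b (poly p) \<le> sqrt C * (b - a) powr (- 1 / 4) * L2_norm_on a b (poly p))}"
  let ?J4 = "integral {a..b} (\<lambda>y. (poly p y) ^ 4)" and ?J2 = "integral {a..b} (\<lambda>y. (poly p y)\<^sup>2)"
  have J2: "?J2 \<ge> 0"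
    by (auto intro!: integral_nonneg integrable_continuous_interval continuous_intros)
  have S_iff: "C \<in> S \<longleftrightarrow> C > 0 \<and> (\<forall>a b p. a < b \<longrightarrow> degree p \<le> k \<longrightarrow>
     integral {a..b} (\<lambda>y. (poly p y) ^ 4) \<le> C\<^sup>2 / (b - a) * (integral {a..b} (\<lambda>y. (poly p y)\<^sup>2))\<^sup>2)" for C
    unfolding S_def using L4_norm_le_iff by blast
  obtain K where "K > 0" and K: "\<And>a b (p :: real poly). a < b \<Longrightarrow> degree p \<le> k \<Longrightarrow>
      integral {a..b} (\<lambda>y. (poly p y) ^ 4) \<le> K / (b - a) * (integral {a..b} (\<lambda>y. (poly p y)\<^sup>2))\<^sup>2"
    using L4_L2_bound by metis
  then have "sqrt K \<in> S" by (simp add: S_iff)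
  have each: "sqrt (b - a) * sqrt ?J4 \<le> C * ?J2" if "C \<in> S" for C
  proof -
    have "?J4 \<le> C\<^sup>2 / (b - a) * ?J2\<^sup>2" "C > 0" using that ab p unfolding S_iff by blast+
    then have "(b - a) * ?J4 \<le> (C * ?J2)\<^sup>2" using ab by (simp add: field_simps)
    then have "sqrt ((b - a) * ?J4) \<le> \<bar>C * ?J2\<bar>" using real_sqrt_le_mono by fastforce
    then show ?thesis using \<open>C > 0\<close> J2 by (simp add: real_sqrt_mult)
  qed
  have "sqrt (b - a) * sqrt ?J4 \<le> C_opt k * ?J2"
  proof (cases "?J2 = 0")
    case True
    then show ?thesis using each[OF \<open>sqrt K \<in> S\<close>] by simp
  next
    case False
    then have pos: "?J2 > 0" using J2 by simp
    have "sqrt (b - a) * sqrt ?J4 / ?J2 \<le> Inf S"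
      using \<open>sqrt K \<in> S\<close> each pos by (intro cInf_greatest) (auto simp: field_simps)
    then show ?thesis using pos by (simp add: C_opt_def S_def field_simps)
  qed
  then show ?thesis using ab by (simp add: field_simps)
qed

section \<open>Deviation from the cell average\<close>

text \<open>
  The constant polynomial 1 on the unit interval has both norms equal to 1.
\<close>

lemma C_opt_ge_1: "1 \<le> C_opt k"
  using C_opt_bound[of 0 1 1 k] by simp

text \<open>
  The right-hand side of the admissibility condition bounds an absolute value, so it suffices to
  exhibit one case where its other factors are positive: $U = \exp$ and $p(y) = y$ on $[0,1]$. The
  sign makes the damping coefficient nonnegative, without which a lower bound for the damping
  integral would be of no use.
\<close>

lemma beta_admissible_nonneg:
  assumes "beta_admissible k \<beta>" "k \<ge> 1"
  shows "\<beta> \<ge> 0"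
proof -
  let ?p = "[:0, 1:] :: real poly"
  define E where "E = integral {0..1} (\<lambda>y. \<bar>poly ?p y - cell_avg 0 1 (poly ?p)\<bar>\<^sup>2)"
  define M where "M = (SUP y\<in>{0..1}. \<bar>(deriv ^^ 3) exp (poly ?p y :: real)\<bar>)"
  have deriv_exp: "(deriv ^^ n) exp = (exp :: real \<Rightarrow> real)" for n
    by (induction n) (auto intro!: DERIV_imp_deriv derivative_eq_intros)
  have deg: "degree ?p \<le> k" using assms(2) by simp
  have "C_diff 3 exp"
    unfolding C_diff_def deriv_exp
    by (auto intro!: continuous_intros simp: real_differentiable_def intro: DERIV_exp)
  then have "\<bar>poly (l2_proj k 0 1 (\<lambda>y. deriv exp (poly ?p y) - deriv exp (poly ?p 0))) 0\<bar>
      \<le> \<beta> / (2 * (1 - 0)) * M * E"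
    using assms(1)[unfolded beta_admissible_def Let_def, rule_format, OF _ zero_less_one deg, THEN conjunct1]
    unfolding M_def E_def by blast
  then have "0 \<le> \<beta> * (M * E)" by simp
  have "E > 0"
    unfolding E_def
    using integral_square_pos[of 0 1 "?p - [:cell_avg 0 1 (poly ?p):]"] by (simp add: power2_eq_square)
  moreover have "M \<ge> 1"
  proof -
    have "bdd_above ((\<lambda>y. \<bar>(deriv ^^ 3) exp (poly ?p y :: real)\<bar>) ` {0..1})"
      unfolding deriv_exp by (rule bdd_aboveI2[of _ _ "exp 1"]) auto
    then have "\<bar>(deriv ^^ 3) exp (poly ?p 0 :: real)\<bar> \<le> M"
      unfolding M_def by (rule cSUP_upper[rotated]) simp
    then show ?thesis by (simp add: deriv_exp)
  qed
  ultimately have "0 < M * E" by (intro mult_pos_pos) auto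
  with \<open>0 \<le> \<beta> * (M * E)\<close> show ?thesis by (simp only: zero_le_mult_iff) linarith
qed

text \<open>
  The extrema of $U''$ and $U'''$ in the damping coefficient run over values of $p$ on the cell only.
  Taylor expansions about the average stay within that range because it is an interval containing
  the average.
\<close>

lemma poly_range_contains_cell_avg:
  assumes "a < b"
  obtains c d where "poly p ` {a..b} = {c..d}" "cell_avg a b (poly p) \<in> {c..d}"
proof -
  have "continuous_on {a..b} (poly p)" by (intro continuous_intros)
  then obtain c d where cd: "poly p ` {a..b} = {c..d}"
    using continuous_image_closed_interval[OF less_imp_le[OF assms]] by blast
  have bounds: "c \<le> poly p y \<and> poly p y \<le> d" if "y \<in> {a..b}" for y
    using imageI[OF that, of "poly p"] unfolding cd by simp
  have "integral {a..b} (\<lambda>y. c) \<le> integral {a..b} (poly p)"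
    by (intro integral_le integrable_continuous_interval continuous_intros) (simp add: bounds)
  moreover have "integral {a..b} (poly p) \<le> integral {a..b} (\<lambda>y. d)"
    by (intro integral_le integrable_continuous_interval continuous_intros) (simp add: bounds)
  ultimately have "cell_avg a b (poly p) \<in> {c..d}" using assms by (simp add: cell_avg_def field_simps)
  with cd show thesis by (rule that)
qed

lemma integral_deviation_cell_avg:
  assumes "a < b"
  shows "integral {a..b} (\<lambda>y. poly p y - cell_avg a b (poly p)) = 0"
  using assms by (subst integral_diff)
    (auto intro!: integrable_continuous_interval continuous_intros simp: cell_avg_def)

text \<open>
  As the deviation has mean zero, the constant $g(\overline p)$ may be subtracted from $g(p)$, and the
  mean value theorem gives $(p - \overline p)(g(p) - g(\overline p)) \ge \min g'\,(p - \overline p)^2$.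
\<close>

lemma monotone_pairing_lower_bound:
  fixes g g' :: "real \<Rightarrow> real"
  assumes ab: "a < b" and g: "\<And>w. (g has_real_derivative g' w) (at w)" and pos: "\<And>w. g' w > 0"
  shows "(INF y\<in>{a..b}. \<bar>g' (poly p y)\<bar>) * integral {a..b} (\<lambda>y. (poly p y - cell_avg a b (poly p))\<^sup>2)
    \<le> integral {a..b} (\<lambda>y. (poly p y - cell_avg a b (poly p)) * g (poly p y))"
proof -
  let ?u = "cell_avg a b (poly p)" and ?m = "INF y\<in>{a..b}. \<bar>g' (poly p y)\<bar>"
  obtain c d where cd: "poly p ` {a..b} = {c..d}" and u: "?u \<in> {c..d}"
    using poly_range_contains_cell_avg[OF ab] .
  have cg: "continuous_on {a..b} (\<lambda>y. g (poly p y))"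
    by (intro continuous_on_DERIV_comp[OF g] continuous_intros)
  have m: "?m \<le> g' w" if "w \<in> {c..d}" for w
  proof -
    have "w \<in> poly p ` {a..b}" using that by (simp only: cd)
    then obtain y where y: "y \<in> {a..b}" "w = poly p y" by blast
    have "bdd_below ((\<lambda>y. \<bar>g' (poly p y)\<bar>) ` {a..b})" by (rule bdd_belowI2[of _ 0]) auto
    then have "?m \<le> \<bar>g' (poly p y)\<bar>" using y(1) by (rule cINF_lower)
    then show ?thesis using pos[of w] y by simp
  qed
  have pointwise: "?m * (poly p y - ?u)\<^sup>2 \<le> (poly p y - ?u) * (g (poly p y) - g ?u)" if y: "y \<in> {a..b}" for y
  proof -
    have py: "poly p y \<in> {c..d}" using y cd by blast
    obtain \<xi> where \<xi>: "\<xi> \<in> {c..d}" "g (poly p y) - g ?u = (poly p y - ?u) * g' \<xi>"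
    proof (cases "poly p y" ?u rule: linorder_cases)
      case less
      obtain \<xi> where "poly p y < \<xi>" "\<xi> < ?u" "g ?u - g (poly p y) = (?u - poly p y) * g' \<xi>"
        using MVT2[OF less, of g g'] g by auto
      then show ?thesis using u py by (intro that[of \<xi>]) (auto simp: algebra_simps)
    next
      case equal
      then show ?thesis using u by (intro that[of ?u]) auto
    next
      case greater
      obtain \<xi> where "?u < \<xi>" "\<xi> < poly p y" "g (poly p y) - g ?u = (poly p y - ?u) * g' \<xi>"
        using MVT2[OF greater, of g g'] g by auto
      then show ?thesis using u py by (intro that[of \<xi>]) auto
    qed
    then show ?thesis using mult_right_mono[OF m[OF \<xi>(1)], of "(poly p y - ?u)\<^sup>2"]
      by (simp add: power2_eq_square mult_ac)
  qed
  have "?m * integral {a..b} (\<lambda>y. (poly p y - ?u)\<^sup>2) = integral {a..b} (\<lambda>y. ?m * (poly p y - ?u)\<^sup>2)"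
    by simp
  also have "\<dots> \<le> integral {a..b} (\<lambda>y. (poly p y - ?u) * (g (poly p y) - g ?u))"
    using pointwise by (intro integral_le integrable_continuous_interval continuous_intros cg) auto
  also have "\<dots> = integral {a..b} (\<lambda>y. (poly p y - ?u) * g (poly p y) - (poly p y - ?u) * g ?u)"
    by (simp only: right_diff_distrib)
  also have "\<dots> = integral {a..b} (\<lambda>y. (poly p y - ?u) * g (poly p y)) - integral {a..b} (\<lambda>y. poly p y - ?u) * g ?u"
    by (simp only: integral_mult_left[symmetric])
      (intro integral_diff integrable_continuous_interval continuous_intros cg)
  finally show ?thesis by (simp only: integral_deviation_cell_avg[OF ab] mult_zero_left diff_zero)
qed

text \<open>
  The residual $R$ is orthogonal to $q = g(\overline p) + g'(\overline p)(p - \overline p)$, so $g(p)$ may be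
  replaced by $g(p) - q$, which is quadratically small in $p - \overline p$. This gains one
  power of the deviation, and makes the error comparable with the damping, which is also quadratic.
\<close>

lemma projection_residual_pairing_bound:
  fixes r g g' g'' :: "real \<Rightarrow> real"
  assumes ab: "a < b" and p: "degree p \<le> k" and r: "continuous_on {a..b} r"
    and g: "\<And>w. (g has_real_derivative g' w) (at w)" and g': "\<And>w. (g' has_real_derivative g'' w) (at w)"
    and g'': "continuous_on UNIV g''"
  shows "\<bar>integral {a..b} (\<lambda>y. (r y - poly (l2_proj k a b r) y) * g (poly p y))\<bar>
    \<le> (SUP y\<in>{a..b}. \<bar>g'' (poly p y)\<bar>) * (C_opt k / (2 * sqrt (b - a)) * L2_norm_on a b (\<lambda>y. r y - poly (l2_proj k a b r) y))
        * integral {a..b} (\<lambda>y. (poly p y - cell_avg a b (poly p))\<^sup>2)"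
proof -
  let ?u = "cell_avg a b (poly p)" and ?M = "SUP y\<in>{a..b}. \<bar>g'' (poly p y)\<bar>"
  define R where "R y = r y - poly (l2_proj k a b r) y" for y
  define q where "q = smult (g' ?u) (p - [:?u:]) + [:g ?u:]"
  define e where "e = p - [:?u:]"
  have dege: "degree e \<le> k" using p by (auto simp: e_def intro!: degree_diff_le)
  then have "degree q \<le> k"
    unfolding q_def e_def[symmetric] by (intro degree_add_le order.trans[OF degree_smult_le]) auto
  obtain c d where cd: "poly p ` {a..b} = {c..d}" and u: "?u \<in> {c..d}"
    using poly_range_contains_cell_avg[OF ab] .
  have cont: "continuous_on {a..b} R" unfolding R_def by (intro continuous_intros r)
  have cg: "continuous_on {a..b} (\<lambda>y. g (poly p y))"
    by (intro continuous_on_DERIV_comp[OF g] continuous_intros)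
  have "continuous_on {a..b} (\<lambda>y. \<bar>g'' (poly p y)\<bar>)"
    by (intro continuous_intros continuous_on_compose2[OF g'']) auto
  from compact_imp_bounded[OF compact_continuous_image[OF this compact_Icc]]
  have bdd: "bdd_above ((\<lambda>y. \<bar>g'' (poly p y)\<bar>) ` {a..b})" by (rule bounded_imp_bdd_above)
  have M: "\<bar>g'' w\<bar> \<le> ?M" if "w \<in> {c..d}" for w
  proof -
    have "w \<in> poly p ` {a..b}" using that by (simp only: cd)
    then obtain y where y: "y \<in> {a..b}" "w = poly p y" by blast
    show ?thesis using cSUP_upper[OF y(1) bdd] y(2) by simp
  qed
  have M0: "?M \<ge> 0" using M[OF u] by linarith
  have Taylor: "\<bar>g (poly p y) - poly q y\<bar> \<le> ?M / 2 * (poly e y)\<^sup>2" if y: "y \<in> {a..b}" for y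
  proof -
    have "poly p y \<in> {c..d}" using y cd by blast
    then have "\<bar>g (poly p y) - g ?u - g' ?u * (poly p y - ?u)\<bar> \<le> ?M / 2 * (poly p y - ?u)\<^sup>2"
      using u by (intro Taylor_remainder_2[OF g g' M]) (auto simp: min_def max_def split: if_splits)
    then show ?thesis by (simp add: q_def e_def algebra_simps)
  qed
  have "integral {a..b} (\<lambda>y. R y * g (poly p y))
      = integral {a..b} (\<lambda>y. R y * (g (poly p y) - poly q y) + R y * poly q y)"
    by (simp add: algebra_simps)
  also have "\<dots> = integral {a..b} (\<lambda>y. R y * (g (poly p y) - poly q y)) + integral {a..b} (\<lambda>y. R y * poly q y)"
    by (intro integral_add integrable_continuous_interval continuous_intros cg cont)
  also have "integral {a..b} (\<lambda>y. R y * poly q y) = 0"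
    unfolding R_def using l2_proj_characterization(2)[OF ab r \<open>degree q \<le> k\<close>] .
  finally have "\<bar>integral {a..b} (\<lambda>y. R y * g (poly p y))\<bar> = \<bar>integral {a..b} (\<lambda>y. R y * (g (poly p y) - poly q y))\<bar>"
    by simp
  also have "\<dots> \<le> integral {a..b} (\<lambda>y. ?M / 2 * (\<bar>R y\<bar> * (poly e y)\<^sup>2))"
  proof (subst real_norm_def[symmetric], rule integral_norm_bound_integral)
    fix y assume "y \<in> {a..b}"
    from mult_left_mono[OF Taylor[OF this], of "\<bar>R y\<bar>"]
    show "norm (R y * (g (poly p y) - poly q y)) \<le> ?M / 2 * (\<bar>R y\<bar> * (poly e y)\<^sup>2)"
      by (simp add: abs_mult mult_ac)
  qed (intro integrable_continuous_interval continuous_intros cg cont)+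
  also have "\<dots> = ?M / 2 * integral {a..b} (\<lambda>y. \<bar>R y\<bar> * (poly e y)\<^sup>2)" by (rule integral_mult_right)
  finally have Taylor_bound: "\<bar>integral {a..b} (\<lambda>y. R y * g (poly p y))\<bar>
    \<le> ?M / 2 * integral {a..b} (\<lambda>y. \<bar>R y\<bar> * (poly e y)\<^sup>2)" .
  have "integral {a..b} (\<lambda>y. \<bar>R y\<bar> * (poly e y)\<^sup>2)
      \<le> sqrt (integral {a..b} (\<lambda>y. \<bar>R y\<bar>\<^sup>2)) * sqrt (integral {a..b} (\<lambda>y. ((poly e y)\<^sup>2)\<^sup>2))"
    by (rule order.trans[OF abs_ge_self Cauchy_Schwarz_integral]) (intro continuous_intros cont)+
  also have "\<dots> = L2_norm_on a b R * sqrt (integral {a..b} (\<lambda>y. (poly e y) ^ 4))"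
    by (simp add: L2_norm_on_def power_mult[symmetric])
  also have "\<dots> \<le> L2_norm_on a b R * (C_opt k / sqrt (b - a) * integral {a..b} (\<lambda>y. (poly e y)\<^sup>2))"
    by (intro mult_left_mono C_opt_bound ab dege)
      (auto simp: L2_norm_on_def intro!: integral_nonneg integrable_continuous_interval continuous_intros cont)
  finally have "?M / 2 * integral {a..b} (\<lambda>y. \<bar>R y\<bar> * (poly e y)\<^sup>2)
    \<le> ?M / 2 * (L2_norm_on a b R * (C_opt k / sqrt (b - a) * integral {a..b} (\<lambda>y. (poly e y)\<^sup>2)))"
    using M0 by (intro mult_left_mono) auto
  also have "\<dots> = ?M * (C_opt k / (2 * sqrt (b - a)) * L2_norm_on a b R) * integral {a..b} (\<lambda>y. (poly e y)\<^sup>2)"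
    by simp
  finally have "\<bar>integral {a..b} (\<lambda>y. R y * g (poly p y))\<bar>
    \<le> ?M * (C_opt k / (2 * sqrt (b - a)) * L2_norm_on a b R) * integral {a..b} (\<lambda>y. (poly e y)\<^sup>2)"
    using Taylor_bound by linarith
  moreover have "poly e = (\<lambda>y. poly p y - ?u)" by (simp add: e_def fun_eq_iff)
  ultimately show ?thesis unfolding R_def[abs_def] by (simp only:)
qed

section \<open>Entropy production at an interface\<close>

text \<open>
  Let $G(w) = U'(w)\hat f - \psi(w)$ with the flux value $\hat f$ held fixed. Since $\psi' = U'' f$, we have
  $G' = U''(w)(\hat f - f(w))$, and the E-flux condition says that $G$ does not increase on the way from
  the left state to the right one.
\<close>

lemma E_flux_entropy_jump:
  assumes flux: "E_flux f fh"
    and \<F>: "\<And>w. (\<F> has_real_derivative deriv U w * f' w) (at w)"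
    and f: "\<And>w. (f has_real_derivative f' w) (at w)"
    and U: "\<And>w. (deriv U has_real_derivative U'' w) (at w)" and convex: "\<And>w. U'' w > 0"
  shows "deriv U r * fh m r - entropy_potential U f \<F> r \<le> num_entropy_flux U f \<F> fh m r"
proof -
  define G where "G w = deriv U w * fh m r - entropy_potential U f \<F> w" for w
  have dG: "(G has_real_derivative U'' w * (fh m r - f w)) (at w)" for w
    unfolding G_def entropy_potential_def
    by (auto intro!: derivative_eq_intros U f \<F> simp: algebra_simps)
  have sgn: "(fh m r - f w) * (r - m) \<le> 0" if "min m r \<le> w" "w \<le> max m r" for w
    using flux that unfolding E_flux_def by blast
  have "G r \<le> G m"
  proof (cases m r rule: linorder_cases)
    case less
    have "U'' w * (fh m r - f w) \<le> 0" if "m \<le> w" "w \<le> r" for w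
      using sgn[of w] that less convex[of w] by (auto simp: mult_le_0_iff)
    with less dG show ?thesis by (intro DERIV_nonpos_imp_nonincreasing[of m r G]) (auto intro!: exI)
  next
    case greater
    have "0 \<le> U'' w * (fh m r - f w)" if "r \<le> w" "w \<le> m" for w
      using sgn[of w] that greater convex[of w] by (auto simp: mult_le_0_iff)
    with greater dG show ?thesis by (intro DERIV_nonneg_imp_nondecreasing[of r m G]) (auto intro!: exI)
  qed simp
  then show ?thesis by (simp add: G_def num_entropy_flux_def)
qed

section \<open>Entropy balance on one cell\<close>

text \<open>
  Test the scheme with the projected entropy variable; the dissipation by damping then covers the
  volume and boundary errors of the projection. The polynomial \<open>q\<close> is the time
  derivative of \<open>p\<close>, and the fluxes enter as two numbers \<open>fl\<close> and
  \<open>fr\<close>, so that the coupling with the neighbouring cells is left to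
  \<open>E_flux_entropy_jump\<close>. Both interface terms therefore carry inner traces.
\<close>

lemma cell_entropy_inequality:
  fixes f f' U \<F> :: "real \<Rightarrow> real"
  defines "fx \<equiv> \<lambda>p. deriv (\<lambda>y. f (poly p y))"
  assumes ab: "a < b" and p: "degree p \<le> k" and q: "degree q \<le> k"
    and f: "\<And>w. (f has_real_derivative f' w) (at w)" and f': "continuous_on UNIV f'"
    and C3: "C_diff 3 U" and convex: "\<And>w. (deriv ^^ 2) U w > 0"
    and \<F>: "\<And>w. (\<F> has_real_derivative deriv U w * f' w) (at w)"
    and k: "k \<ge> 1" and \<beta>: "beta_admissible k \<beta>"
    and B: "B = (SUP y\<in>{a..b}. \<bar>(deriv ^^ 3) U (poly p y)\<bar>) / (INF y\<in>{a..b}. \<bar>(deriv ^^ 2) U (poly p y)\<bar>)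
      * (C_opt k / (2 * sqrt (b - a)) * L2_norm_on a b (\<lambda>y. fx p y - poly (l2_proj k a b (fx p)) y)
         + \<beta> / (2 * (b - a)) * (\<bar>fl - f (poly p a)\<bar> + \<bar>- fr + f (poly p b)\<bar>))"
    and scheme: "\<And>v. degree v \<le> k \<Longrightarrow>
      integral {a..b} (\<lambda>y. poly q y * poly v y) - integral {a..b} (\<lambda>y. f (poly p y) * poly (pderiv v) y)
        + fr * poly v b - fl * poly v a
      = - B * integral {a..b} (\<lambda>y. (poly p y - cell_avg a b (poly p)) * poly v y)"
  shows "integral {a..b} (\<lambda>y. deriv U (poly p y) * poly q y)
    + (deriv U (poly p b) * fr - entropy_potential U f \<F> (poly p b))
    - (deriv U (poly p a) * fl - entropy_potential U f \<F> (poly p a)) \<le> 0"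
proof -
  have U1: "(deriv U has_real_derivative (deriv ^^ 2) U w) (at w)"
    and U2: "((deriv ^^ 2) U has_real_derivative (deriv ^^ 3) U w) (at w)" for w
    using C_diff_DERIV[OF C3, of 1 w] C_diff_DERIV[OF C3, of 2 w]
    by (simp_all add: numeral_2_eq_2 numeral_3_eq_3)
  have U3: "continuous_on UNIV ((deriv ^^ 3) U)" using C3 by (simp add: C_diff_def)
  have fx: "fx p = (\<lambda>y. f' (poly p y) * poly (pderiv p) y)"
    unfolding fx_def by (rule ext, rule DERIV_imp_deriv, rule DERIV_chain2[OF f poly_DERIV])
  have cfx: "continuous_on {a..b} (fx p)"
    unfolding fx by (intro continuous_intros continuous_on_compose2[OF f']) auto
  define w where "w y = deriv U (poly p y)" for y
  define v where "v = l2_proj k a b w"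
  define \<pi>f where "\<pi>f = l2_proj k a b (fx p)"
  define E where "E = integral {a..b} (\<lambda>y. (poly p y - cell_avg a b (poly p))\<^sup>2)"
  define M3 where "M3 = (SUP y\<in>{a..b}. \<bar>(deriv ^^ 3) U (poly p y)\<bar>)"
  define m2 where "m2 = (INF y\<in>{a..b}. \<bar>(deriv ^^ 2) U (poly p y)\<bar>)"
  define L where "L = C_opt k / (2 * sqrt (b - a)) * L2_norm_on a b (\<lambda>y. fx p y - poly \<pi>f y)"
  define Hp where "Hp = fl - f (poly p a)"
  define Hm where "Hm = - fr + f (poly p b)"
  define X where "X = integral {a..b} (\<lambda>y. (poly p y - cell_avg a b (poly p)) * w y)"
  define R where "R = integral {a..b} (\<lambda>y. (fx p y - poly \<pi>f y) * w y)"
  have cw: "continuous_on {a..b} w" unfolding w_def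
    by (intro continuous_on_DERIV_comp[OF U1] continuous_intros)
  have cf: "continuous_on {a..b} (\<lambda>y. f (poly p y))"
    by (intro continuous_on_DERIV_comp[OF f] continuous_intros)
  have degv: "degree v \<le> k" unfolding v_def by (rule l2_proj_characterization(1)[OF ab cw])
  have deg\<pi>: "degree \<pi>f \<le> k" unfolding \<pi>f_def by (rule l2_proj_characterization(1)[OF ab cfx])
  note integ = integrable_continuous_interval continuous_intros cw cf cfx
  \<comment> \<open>Symmetry of the projection: against polynomials, \<open>v\<close> and \<open>w\<close> are interchangeable.\<close>
  have pair_v: "integral {a..b} (\<lambda>y. poly r y * poly v y) = integral {a..b} (\<lambda>y. poly r y * w y)"
    if r: "degree r \<le> k" for r
  proof -
    have "0 = integral {a..b} (\<lambda>y. (w y - poly v y) * poly r y)"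
      unfolding v_def using l2_proj_characterization(2)[OF ab cw r] by simp
    also have "\<dots> = integral {a..b} (\<lambda>y. poly r y * w y - poly r y * poly v y)"
      by (simp add: algebra_simps)
    also have "\<dots> = integral {a..b} (\<lambda>y. poly r y * w y) - integral {a..b} (\<lambda>y. poly r y * poly v y)"
      by (intro integral_diff integ)
    finally show ?thesis by simp
  qed
  have time: "integral {a..b} (\<lambda>y. deriv U (poly p y) * poly q y) = integral {a..b} (\<lambda>y. poly q y * poly v y)"
    unfolding pair_v[OF q] by (simp add: w_def mult.commute)
  have "degree (p - [:cell_avg a b (poly p):]) \<le> k" using p by (intro degree_diff_le) auto
  from pair_v[OF this]
  have damp: "integral {a..b} (\<lambda>y. (poly p y - cell_avg a b (poly p)) * poly v y) = X"
    by (simp add: X_def)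
  have parts: "integral {a..b} (\<lambda>y. f (poly p y) * poly (pderiv v) y) + integral {a..b} (\<lambda>y. fx p y * poly v y)
      = f (poly p b) * poly v b - f (poly p a) * poly v a"
  proof -
    have "((\<lambda>y. f (poly p y) * poly (pderiv v) y + fx p y * poly v y) has_integral
        f (poly p b) * poly v b - f (poly p a) * poly v a) {a..b}"
    proof (rule fundamental_theorem_of_calculus)
      fix y
      have "((\<lambda>y. f (poly p y)) has_real_derivative fx p y) (at y)"
        unfolding fx by (rule DERIV_chain2[OF f poly_DERIV])
      from DERIV_mult[OF this poly_DERIV[of v y]]
      have "((\<lambda>y. f (poly p y) * poly v y) has_real_derivative
        f (poly p y) * poly (pderiv v) y + fx p y * poly v y) (at y)"
        by (simp only: ac_simps)
      then show "((\<lambda>y. f (poly p y) * poly v y) has_vector_derivative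
        f (poly p y) * poly (pderiv v) y + fx p y * poly v y) (at y within {a..b})"
        unfolding has_real_derivative_iff_has_vector_derivative[symmetric]
        by (rule has_field_derivative_at_within)
    qed (use ab in simp)
    then have "integral {a..b} (\<lambda>y. f (poly p y) * poly (pderiv v) y + fx p y * poly v y)
        = f (poly p b) * poly v b - f (poly p a) * poly v a" by (rule integral_unique)
    moreover have "integral {a..b} (\<lambda>y. f (poly p y) * poly (pderiv v) y + fx p y * poly v y)
        = integral {a..b} (\<lambda>y. f (poly p y) * poly (pderiv v) y) + integral {a..b} (\<lambda>y. fx p y * poly v y)"
      by (intro integral_add integ)
    ultimately show ?thesis by simp
  qed
  have transport: "integral {a..b} (\<lambda>y. fx p y * poly v y) = \<F> (poly p b) - \<F> (poly p a) - R"
  proof -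
    have "((\<lambda>y. fx p y * w y) has_integral \<F> (poly p b) - \<F> (poly p a)) {a..b}"
    proof (rule fundamental_theorem_of_calculus)
      fix y
      have "((\<lambda>y. \<F> (poly p y)) has_real_derivative fx p y * w y) (at y)"
        using DERIV_chain2[OF \<F> poly_DERIV, of p y] by (simp only: fx w_def ac_simps)
      then show "((\<lambda>y. \<F> (poly p y)) has_vector_derivative fx p y * w y) (at y within {a..b})"
        unfolding has_real_derivative_iff_has_vector_derivative[symmetric]
        by (rule has_field_derivative_at_within)
    qed (use ab in simp)
    then have "\<F> (poly p b) - \<F> (poly p a) = integral {a..b} (\<lambda>y. fx p y * w y)"
      by (rule integral_unique[symmetric])
    also have "\<dots> = integral {a..b} (\<lambda>y. (fx p y - poly \<pi>f y) * w y + poly \<pi>f y * w y)"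
      by (simp add: algebra_simps)
    also have "\<dots> = R + integral {a..b} (\<lambda>y. poly \<pi>f y * w y)"
      unfolding R_def by (intro integral_add integ)
    also have "integral {a..b} (\<lambda>y. poly \<pi>f y * w y)
      = integral {a..b} (\<lambda>y. (fx p y - poly \<pi>f y) * poly v y) + integral {a..b} (\<lambda>y. poly \<pi>f y * poly v y)"
      using l2_proj_characterization(2)[OF ab cfx degv] pair_v[OF deg\<pi>] by (simp add: \<pi>f_def)
    also have "\<dots> = integral {a..b} (\<lambda>y. (fx p y - poly \<pi>f y) * poly v y + poly \<pi>f y * poly v y)"
      by (intro integral_add[symmetric] integ)
    also have "\<dots> = integral {a..b} (\<lambda>y. fx p y * poly v y)" by (simp add: algebra_simps)
    finally show ?thesis by simp
  qed
  have R: "\<bar>R\<bar> \<le> M3 * L * E"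
    unfolding R_def M3_def L_def E_def w_def \<pi>f_def
    by (rule projection_residual_pairing_bound[OF ab p cfx U1 U2 U3])
  have X: "m2 * E \<le> X"
    unfolding m2_def E_def X_def w_def by (rule monotone_pairing_lower_bound[OF ab U1 convex])
  \<comment> \<open>Bound for the projection error of the entropy variable at either end-point.\<close>
  define \<delta> where "\<delta> = \<beta> / (2 * (b - a)) * M3 * E"
  have ends: "\<bar>poly v a - w a\<bar> \<le> \<delta>" "\<bar>poly v b - w b\<bar> \<le> \<delta>"
  proof -
    have "\<bar>poly (l2_proj k a b (\<lambda>y. w y - w a)) a\<bar> \<le> \<delta> \<and> \<bar>poly (l2_proj k a b (\<lambda>y. w y - w b)) b\<bar> \<le> \<delta>"
      using \<beta>[unfolded beta_admissible_def Let_def, rule_format, OF C3 ab p]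
      unfolding \<delta>_def M3_def E_def w_def power2_abs .
    then show "\<bar>poly v a - w a\<bar> \<le> \<delta>" "\<bar>poly v b - w b\<bar> \<le> \<delta>"
      by (simp_all add: l2_proj_diff_const[OF ab cw] v_def)
  qed
  have compact_range: "\<exists>y\<in>{a..b}. \<forall>z\<in>{a..b}. \<bar>(deriv ^^ 2) U (poly p y)\<bar> \<le> \<bar>(deriv ^^ 2) U (poly p z)\<bar>"
    using ab by (intro continuous_attains_inf continuous_intros continuous_on_DERIV_comp[OF U2]) auto
  then obtain y0 where y0: "\<And>z. z \<in> {a..b} \<Longrightarrow> \<bar>(deriv ^^ 2) U (poly p y0)\<bar> \<le> \<bar>(deriv ^^ 2) U (poly p z)\<bar>"
    by blast
  have "\<bar>(deriv ^^ 2) U (poly p y0)\<bar> \<le> m2"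
    unfolding m2_def using ab by (intro cINF_greatest y0) auto
  then have m2: "m2 > 0" using convex[of "poly p y0"] by linarith
  have M3: "M3 \<ge> 0"
  proof -
    have "continuous_on {a..b} (\<lambda>y. \<bar>(deriv ^^ 3) U (poly p y)\<bar>)"
      by (intro continuous_intros continuous_on_compose2[OF U3]) auto
    from compact_imp_bounded[OF compact_continuous_image[OF this compact_Icc]]
    have "\<bar>(deriv ^^ 3) U (poly p a)\<bar> \<le> M3" unfolding M3_def
      using ab by (intro cSUP_upper bounded_imp_bdd_above) auto
    then show ?thesis by linarith
  qed
  define S where "S = L + \<beta> / (2 * (b - a)) * (\<bar>Hp\<bar> + \<bar>Hm\<bar>)"
  have L0: "L \<ge> 0" unfolding L_def L2_norm_on_def using C_opt_ge_1[of k] ab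
    by (intro mult_nonneg_nonneg divide_nonneg_nonneg real_sqrt_ge_zero integral_nonneg integ) auto
  have S0: "S \<ge> 0" unfolding S_def using L0 beta_admissible_nonneg[OF \<beta> k] ab
    by (intro add_nonneg_nonneg mult_nonneg_nonneg divide_nonneg_nonneg) auto
  have B': "B = M3 / m2 * S"
    unfolding B M3_def m2_def S_def L_def Hp_def Hm_def \<pi>f_def by simp
  have "M3 * S * E = B * (m2 * E)" using m2 by (simp add: B')
  also have "\<dots> \<le> B * X"
    using X M3 m2 S0 by (intro mult_left_mono) (auto simp: B')
  finally have dissipation: "M3 * S * E \<le> B * X" .
  \<comment> \<open>The damping budget is exactly the sum of the volume and the boundary error bounds.\<close>
  have MSE: "M3 * S * E = M3 * L * E + (\<bar>Hp\<bar> + \<bar>Hm\<bar>) * \<delta>"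
    by (simp add: S_def \<delta>_def algebra_simps)
  have "Hp * (poly v a - w a) \<le> \<bar>Hp\<bar> * \<delta>" "Hm * (poly v b - w b) \<le> \<bar>Hm\<bar> * \<delta>"
    using ends by (auto intro: order.trans[OF abs_ge_self] simp: abs_mult mult_left_mono)
  with R MSE dissipation
  have "R + Hp * (poly v a - w a) + Hm * (poly v b - w b) - B * X \<le> 0"
    unfolding distrib_right by linarith
  moreover have "integral {a..b} (\<lambda>y. poly q y * poly v y)
      = Hm * poly v b + Hp * poly v a - (\<F> (poly p b) - \<F> (poly p a)) + R - B * X"
    using scheme[OF degv] parts transport unfolding damp Hp_def Hm_def by (simp add: algebra_simps)
  ultimately have "integral {a..b} (\<lambda>y. poly q y * poly v y)
     \<le> Hm * w b + Hp * w a - (\<F> (poly p b) - \<F> (poly p a))"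
    by (simp add: algebra_simps)
  then show ?thesis
    unfolding time by (simp add: entropy_potential_def Hp_def Hm_def w_def algebra_simps)
qed

section \<open>Evolution in time\<close>

text \<open>
  Both sides agree at the $k+1$ nodes and have degree at most $k$. The point of the formula is that
  the coefficients are values of the polynomial.
\<close>

lemma poly_Lagrange_interpolation:
  fixes k :: nat
  assumes "infinite A"
  obtains y :: "nat \<Rightarrow> 'a :: field" and l :: "nat \<Rightarrow> 'a poly"
  where "\<And>i. i \<le> k \<Longrightarrow> y i \<in> A" "\<And>i. i \<le> k \<Longrightarrow> degree (l i) \<le> k"
    "\<And>p. degree p \<le> k \<Longrightarrow> p = (\<Sum>i\<le>k. smult (poly p (y i)) (l i))"
proof -
  obtain y :: "nat \<Rightarrow> 'a" where y: "inj y" "range y \<subseteq> A"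
    using infinite_countable_subset[OF assms] by blast
  define l where "l i = (\<Prod>m\<in>{..k} - {i}. [:- y m / (y i - y m), 1 / (y i - y m):])" for i
  have deg: "degree (l i) \<le> k" if "i \<le> k" for i
  proof -
    have "degree (l i) \<le> (\<Sum>m\<in>{..k} - {i}. degree [:- y m / (y i - y m), 1 / (y i - y m):])"
      unfolding l_def by (rule order.trans[OF degree_prod_sum_le]) (auto simp: o_def)
    also have "\<dots> \<le> (\<Sum>m\<in>{..k} - {i}. 1)" by (intro sum_mono) auto
    finally show ?thesis using that by simp
  qed
  have l_node: "poly (l i) (y j) = (if i = j then 1 else 0)" if "i \<le> k" "j \<le> k" for i j
  proof (cases "i = j")
    case True
    have "poly (l i) (y j) = (\<Prod>m\<in>{..k} - {i}. 1)"
      unfolding l_def poly_prod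
      by (rule prod.cong) (use y True in \<open>auto simp: inj_def diff_divide_distrib[symmetric] add.commute\<close>)
    then show ?thesis using True by simp
  next
    case False
    then have "poly (l i) (y j) = 0"
      unfolding l_def poly_prod by (intro prod_zero) (use that in auto)
    with False show ?thesis by simp
  qed
  show thesis
  proof (rule that)
    fix p :: "'a poly" assume p: "degree p \<le> k"
    show "p = (\<Sum>i\<le>k. smult (poly p (y i)) (l i))"
    proof (rule poly_eqI_degree[of "y ` {..k}"])
      have card: "card (y ` {..k}) = Suc k" using y by (simp add: card_image inj_on_def inj_def)
      show "card (y ` {..k}) > degree p" using p card by simp
      have "degree (\<Sum>i\<le>k. smult (poly p (y i)) (l i)) \<le> k"
        using deg by (intro degree_sum_le) (auto intro: order.trans[OF degree_smult_le])
      then show "card (y ` {..k}) > degree (\<Sum>i\<le>k. smult (poly p (y i)) (l i))" using card by simp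
      show "poly p x = poly (\<Sum>i\<le>k. smult (poly p (y i)) (l i)) x" if x: "x \<in> y ` {..k}" for x
      proof -
        obtain j where j: "j \<le> k" "x = y j" using x by auto
        have "poly (\<Sum>i\<le>k. smult (poly p (y i)) (l i)) x = (\<Sum>i\<le>k. if i = j then poly p (y i) else 0)"
          unfolding poly_sum by (rule sum.cong) (auto simp: j l_node)
        then show ?thesis using j by simp
      qed
    qed
  qed (use y deg in auto)
qed

text \<open>
  The coefficients are only assumed differentiable at the single time $t$, so a Leibniz rule
  that requires a continuous derivative near $t$ does not apply. Instead
  the increment of the integral is split into its linear part
  \<open>L\<close> in the increments $c_i(s) - c_i(t)$ and a remainder bounded by a multiple of
  the quadratic form \<open>Q\<close> in these increments. Both are finite sums, so the product rule
  applies, and it shows that \<open>Q\<close> has derivative zero.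
\<close>

lemma has_real_derivative_integral_comp:
  fixes c :: "'i \<Rightarrow> real \<Rightarrow> real" and l :: "'i \<Rightarrow> real \<Rightarrow> real" and g g' g'' :: "real \<Rightarrow> real"
  assumes I: "finite I" and l: "\<And>i. i \<in> I \<Longrightarrow> continuous_on {a..b} (l i)"
    and c: "\<And>i. i \<in> I \<Longrightarrow> (c i has_real_derivative c' i) (at t within T)"
    and g: "\<And>w. (g has_real_derivative g' w) (at w)"
    and g': "\<And>w. (g' has_real_derivative g'' w) (at w)"
    and g'': "continuous_on UNIV g''"
  shows "((\<lambda>s. integral {a..b} (\<lambda>y. g (\<Sum>i\<in>I. c i s * l i y))) has_real_derivative
    integral {a..b} (\<lambda>y. g' (\<Sum>i\<in>I. c i t * l i y) * (\<Sum>i\<in>I. c' i * l i y))) (at t within T)"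
proof -
  define P where "P s y = (\<Sum>i\<in>I. c i s * l i y)" for s y
  define \<Phi> where "\<Phi> s = integral {a..b} (\<lambda>y. g (P s y))" for s
  have contP: "continuous_on {a..b} (P s)" for s
    unfolding P_def by (intro continuous_intros l)
  note cg = continuous_on_DERIV_comp[OF g] continuous_on_DERIV_comp[OF g']
  have dc: "((\<lambda>s. c i s - c i t) has_real_derivative c' i) (at t within T)" if "i \<in> I" for i
    using DERIV_diff[OF c[OF that] DERIV_const[of "c i t"]] by simp
  define L where "L s = integral {a..b} (\<lambda>y. g' (P t y) * (P s y - P t y))" for s
  define Q where "Q s = integral {a..b} (\<lambda>y. (P s y - P t y)\<^sup>2)" for s
  have "L = (\<lambda>s. \<Sum>i\<in>I. (c i s - c i t) * integral {a..b} (\<lambda>y. g' (P t y) * l i y))"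
  proof
    fix s
    have "L s = integral {a..b} (\<lambda>y. \<Sum>i\<in>I. (c i s - c i t) * (g' (P t y) * l i y))"
      unfolding L_def by (rule integral_cong) (simp add: P_def sum_subtractf[symmetric] sum_distrib_left algebra_simps)
    also have "\<dots> = (\<Sum>i\<in>I. integral {a..b} (\<lambda>y. (c i s - c i t) * (g' (P t y) * l i y)))"
      by (intro integral_sum I integrable_continuous_interval continuous_intros l cg contP)
    finally show "L s = (\<Sum>i\<in>I. (c i s - c i t) * integral {a..b} (\<lambda>y. g' (P t y) * l i y))" by simp
  qed
  moreover have "((\<lambda>s. \<Sum>i\<in>I. (c i s - c i t) * integral {a..b} (\<lambda>y. g' (P t y) * l i y))
      has_real_derivative (\<Sum>i\<in>I. c' i * integral {a..b} (\<lambda>y. g' (P t y) * l i y))) (at t within T)"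
    by (intro DERIV_sum DERIV_cmult_right dc)
  moreover have "(\<Sum>i\<in>I. c' i * integral {a..b} (\<lambda>y. g' (P t y) * l i y))
      = integral {a..b} (\<lambda>y. g' (P t y) * (\<Sum>i\<in>I. c' i * l i y))"
  proof -
    have "integral {a..b} (\<lambda>y. g' (P t y) * (\<Sum>i\<in>I. c' i * l i y))
      = integral {a..b} (\<lambda>y. \<Sum>i\<in>I. c' i * (g' (P t y) * l i y))"
      by (rule integral_cong) (simp add: sum_distrib_left algebra_simps)
    also have "\<dots> = (\<Sum>i\<in>I. integral {a..b} (\<lambda>y. c' i * (g' (P t y) * l i y)))"
      by (intro integral_sum I integrable_continuous_interval continuous_intros l cg contP)
    finally show ?thesis by simp
  qed
  ultimately have L: "(L has_real_derivative integral {a..b} (\<lambda>y. g' (P t y) * (\<Sum>i\<in>I. c' i * l i y))) (at t within T)"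
    by simp
  have "Q = (\<lambda>s. \<Sum>i\<in>I. \<Sum>m\<in>I. (c i s - c i t) * (c m s - c m t) * integral {a..b} (\<lambda>y. l i y * l m y))"
  proof
    fix s
    have "Q s = integral {a..b} (\<lambda>y. \<Sum>i\<in>I. \<Sum>m\<in>I. (c i s - c i t) * (c m s - c m t) * (l i y * l m y))"
      unfolding Q_def power2_eq_square
      by (rule integral_cong)
        (simp add: P_def sum_subtractf[symmetric] sum_product left_diff_distrib[symmetric] mult_ac)
    also have "\<dots> = (\<Sum>i\<in>I. integral {a..b} (\<lambda>y. \<Sum>m\<in>I. (c i s - c i t) * (c m s - c m t) * (l i y * l m y)))"
      by (intro integral_sum I integrable_continuous_interval continuous_intros l)
    also have "\<dots> = (\<Sum>i\<in>I. \<Sum>m\<in>I. integral {a..b} (\<lambda>y. (c i s - c i t) * (c m s - c m t) * (l i y * l m y)))"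
      by (intro integral_sum sum.cong refl I integrable_continuous_interval continuous_intros l)
    finally show "Q s = (\<Sum>i\<in>I. \<Sum>m\<in>I. (c i s - c i t) * (c m s - c m t) * integral {a..b} (\<lambda>y. l i y * l m y))"
      by simp
  qed
  moreover have "((\<lambda>s. \<Sum>i\<in>I. \<Sum>m\<in>I. (c i s - c i t) * (c m s - c m t) * integral {a..b} (\<lambda>y. l i y * l m y))
    has_real_derivative (\<Sum>i\<in>I. \<Sum>m\<in>I. 0)) (at t within T)"
  proof (intro DERIV_sum)
    fix i m assume "i \<in> I" "m \<in> I"
    from DERIV_cmult_right[OF DERIV_mult[OF dc[OF this(1)] dc[OF this(2)]], of "integral {a..b} (\<lambda>y. l i y * l m y)"]
    show "((\<lambda>s. (c i s - c i t) * (c m s - c m t) * integral {a..b} (\<lambda>y. l i y * l m y))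
      has_real_derivative 0) (at t within T)" by simp
  qed
  ultimately have Q: "(Q has_real_derivative 0) (at t within T)" by simp
  have Qt: "Q t = 0" and Lt: "L t = 0" by (simp_all add: Q_def L_def)
  obtain A where A: "\<And>y. y \<in> {a..b} \<Longrightarrow> \<bar>P t y\<bar> \<le> A"
    using continuous_on_Icc_bounded[OF contP] by metis
  obtain M where M: "\<And>w. w \<in> {- (A + 1)..A + 1} \<Longrightarrow> \<bar>g'' w\<bar> \<le> M"
    using continuous_on_Icc_bounded[OF continuous_on_subset[OF g'' subset_UNIV]] by metis
  have "\<exists>B. \<forall>y\<in>{a..b}. \<bar>l i y\<bar> \<le> B" if "i \<in> I" for i
    using continuous_on_Icc_bounded[OF l[OF that]] by metis
  then obtain B where B: "\<And>i y. i \<in> I \<Longrightarrow> y \<in> {a..b} \<Longrightarrow> \<bar>l i y\<bar> \<le> B i" by metis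
  have "((\<lambda>s. \<Sum>i\<in>I. \<bar>c i s - c i t\<bar> * B i) \<longlongrightarrow> (\<Sum>i\<in>I. \<bar>c i t - c i t\<bar> * B i)) (at t within T)"
    using DERIV_continuous[OF c] by (intro tendsto_intros) (auto simp: continuous_within)
  then have "\<forall>\<^sub>F s in at t within T. (\<Sum>i\<in>I. \<bar>c i s - c i t\<bar> * B i) < 1"
    by (intro order_tendstoD) auto
  then have near: "\<forall>\<^sub>F s in at t within T. \<bar>\<Phi> s - \<Phi> t - L s\<bar> \<le> M / 2 * Q s"
  proof (rule eventually_mono)
    fix s assume s: "(\<Sum>i\<in>I. \<bar>c i s - c i t\<bar> * B i) < 1"
    have close: "\<bar>P s y - P t y\<bar> \<le> 1" if "y \<in> {a..b}" for y
    proof -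
      have "\<bar>P s y - P t y\<bar> = \<bar>\<Sum>i\<in>I. (c i s - c i t) * l i y\<bar>"
        by (simp add: P_def sum_subtractf[symmetric] algebra_simps)
      also have "\<dots> \<le> (\<Sum>i\<in>I. \<bar>c i s - c i t\<bar> * B i)"
        using B that by (intro order.trans[OF sum_abs] sum_mono) (auto simp: abs_mult intro!: mult_left_mono)
      finally show ?thesis using s by simp
    qed
    have "\<Phi> s - \<Phi> t - L s = integral {a..b} (\<lambda>y. g (P s y) - g (P t y)) - L s"
      unfolding \<Phi>_def
      by (subst integral_diff) (intro refl integrable_continuous_interval cg contP)+
    also have "\<dots> = integral {a..b} (\<lambda>y. g (P s y) - g (P t y) - g' (P t y) * (P s y - P t y))"
      unfolding L_def
      by (rule integral_diff[symmetric]) (intro integrable_continuous_interval continuous_intros cg contP)+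
    finally have "\<bar>\<Phi> s - \<Phi> t - L s\<bar>
      = \<bar>integral {a..b} (\<lambda>y. g (P s y) - g (P t y) - g' (P t y) * (P s y - P t y))\<bar>"
      by (rule arg_cong)
    also have "\<dots> \<le> integral {a..b} (\<lambda>y. M / 2 * (P s y - P t y)\<^sup>2)"
    proof (subst real_norm_def[symmetric], rule integral_norm_bound_integral)
      fix y assume y: "y \<in> {a..b}"
      show "norm (g (P s y) - g (P t y) - g' (P t y) * (P s y - P t y)) \<le> M / 2 * (P s y - P t y)\<^sup>2"
        unfolding real_norm_def
        by (rule Taylor_remainder_2[OF g g' M]) (use close[OF y] A[OF y] in \<open>auto simp: min_def max_def split: if_splits\<close>)
    qed (intro integrable_continuous_interval continuous_intros cg contP)+
    finally show "\<bar>\<Phi> s - \<Phi> t - L s\<bar> \<le> M / 2 * Q s" by (simp add: Q_def)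
  qed
  have "((\<lambda>s. \<Phi> s - \<Phi> t - L s) has_real_derivative 0) (at t within T)"
    unfolding has_field_derivative_iff
  proof (rule Lim_null_comparison)
    show "((\<lambda>s. \<bar>M / 2\<bar> * \<bar>(Q s - Q t) / (s - t)\<bar>) \<longlongrightarrow> 0) (at t within T)"
      using tendsto_mult_right_zero[OF tendsto_rabs_zero, of "\<lambda>s. (Q s - Q t) / (s - t)" _ "\<bar>M / 2\<bar>"]
        Q unfolding has_field_derivative_iff by simp
    show "\<forall>\<^sub>F s in at t within T. norm ((\<Phi> s - \<Phi> t - L s - (\<Phi> t - \<Phi> t - L t)) / (s - t))
      \<le> \<bar>M / 2\<bar> * \<bar>(Q s - Q t) / (s - t)\<bar>"
      using near
    proof (rule eventually_mono)
      fix s assume "\<bar>\<Phi> s - \<Phi> t - L s\<bar> \<le> M / 2 * Q s"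
      also have "\<dots> \<le> \<bar>M / 2 * Q s\<bar>" by simp
      finally have "\<bar>\<Phi> s - \<Phi> t - L s\<bar> / \<bar>s - t\<bar> \<le> \<bar>M / 2 * Q s\<bar> / \<bar>s - t\<bar>"
        by (rule divide_right_mono) simp
      then show "norm ((\<Phi> s - \<Phi> t - L s - (\<Phi> t - \<Phi> t - L t)) / (s - t))
        \<le> \<bar>M / 2\<bar> * \<bar>(Q s - Q t) / (s - t)\<bar>"
        by (simp add: Qt Lt abs_mult)
    qed
  qed
  from DERIV_add[OF DERIV_add[OF this L] DERIV_const[of "\<Phi> t"]]
  show ?thesis by (simp add: \<Phi>_def P_def)
qed

text \<open>
  By interpolation, the values at $k+1$ nodes carry the whole time dependence. The derivatives
  of these values interpolate to a polynomial \<open>q\<close>, and since derivatives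
  are unique it agrees with the pointwise time derivative everywhere on the cell.
\<close>

lemma time_derivative_of_cell_polynomial:
  fixes P :: "real \<Rightarrow> real poly"
  assumes ab: "a < b" and t: "t \<in> T" and nontrivial: "at t within T \<noteq> bot"
    and deg: "\<And>s. s \<in> T \<Longrightarrow> degree (P s) \<le> k"
    and diff: "\<And>y. y \<in> {a..b} \<Longrightarrow> (\<lambda>s. poly (P s) y) differentiable (at t within T)"
    and g: "\<And>w. (g has_real_derivative g' w) (at w)"
    and g': "\<And>w. (g' has_real_derivative g'' w) (at w)" and g'': "continuous_on UNIV g''"
  obtains q where "degree q \<le> k"
    and "\<And>y. y \<in> {a..b} \<Longrightarrow> vector_derivative (\<lambda>s. poly (P s) y) (at t within T) = poly q y"
    and "((\<lambda>s. integral {a..b} (\<lambda>y. g (poly (P s) y))) has_real_derivative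
      integral {a..b} (\<lambda>y. g' (poly (P t) y) * poly q y)) (at t within T)"
proof -
  obtain y :: "nat \<Rightarrow> real" and l :: "nat \<Rightarrow> real poly" where
    y: "\<And>i. i \<le> k \<Longrightarrow> y i \<in> {a..b}" and l: "\<And>i. i \<le> k \<Longrightarrow> degree (l i) \<le> k" and
    interp: "\<And>p. degree p \<le> k \<Longrightarrow> p = (\<Sum>i\<le>k. smult (poly p (y i)) (l i))"
    using poly_Lagrange_interpolation[OF infinite_Icc[OF ab], of k] by blast
  define c where "c i s = poly (P s) (y i)" for i s
  define c' where "c' i = vector_derivative (c i) (at t within T)" for i
  define q where "q = (\<Sum>i\<le>k. smult (c' i) (l i))"
  have c: "(c i has_real_derivative c' i) (at t within T)" if "i \<le> k" for i
    using diff[OF y[OF that]] unfolding c'_def has_real_derivative_iff_has_vector_derivative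
    by (simp add: vector_derivative_works[symmetric] c_def[abs_def])
  have P: "poly (P s) z = (\<Sum>i\<le>k. c i s * poly (l i) z)" if "s \<in> T" for s z
    by (subst interp[OF deg[OF that]]) (simp add: poly_sum c_def)
  have q: "poly q z = (\<Sum>i\<le>k. c' i * poly (l i) z)" for z by (simp add: q_def poly_sum)
  show thesis
  proof (rule that)
    show "degree q \<le> k"
      unfolding q_def using l by (intro degree_sum_le) (auto intro: order.trans[OF degree_smult_le])
    show "vector_derivative (\<lambda>s. poly (P s) z) (at t within T) = poly q z" if z: "z \<in> {a..b}" for z
    proof (rule vector_derivative_unique_within[OF nontrivial])
      show "((\<lambda>s. poly (P s) z) has_vector_derivative vector_derivative (\<lambda>s. poly (P s) z) (at t within T)) (at t within T)"
        using diff[OF z] by (simp add: vector_derivative_works)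
      have "((\<lambda>s. \<Sum>i\<le>k. c i s * poly (l i) z) has_real_derivative (\<Sum>i\<le>k. c' i * poly (l i) z)) (at t within T)"
        by (intro DERIV_sum DERIV_cmult_right c) simp
      then have "((\<lambda>s. poly (P s) z) has_real_derivative (\<Sum>i\<le>k. c' i * poly (l i) z)) (at t within T)"
        by (rule has_field_derivative_transform_within[OF _ zero_less_one t]) (simp only: P)
      then show "((\<lambda>s. poly (P s) z) has_vector_derivative poly q z) (at t within T)"
        by (simp only: q has_real_derivative_iff_has_vector_derivative)
    qed
    have "((\<lambda>s. integral {a..b} (\<lambda>z. g (\<Sum>i\<le>k. c i s * poly (l i) z))) has_real_derivative
      integral {a..b} (\<lambda>z. g' (\<Sum>i\<le>k. c i t * poly (l i) z) * (\<Sum>i\<le>k. c' i * poly (l i) z))) (at t within T)"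
      by (rule has_real_derivative_integral_comp[OF _ _ c g g' g'']) (auto intro!: continuous_intros)
    then have "((\<lambda>s. integral {a..b} (\<lambda>z. g (\<Sum>i\<le>k. c i s * poly (l i) z))) has_real_derivative
      integral {a..b} (\<lambda>z. g' (poly (P t) z) * poly q z)) (at t within T)"
      by (simp only: P[OF t] q)
    then show "((\<lambda>s. integral {a..b} (\<lambda>z. g (poly (P s) z))) has_real_derivative
      integral {a..b} (\<lambda>z. g' (poly (P t) z) * poly q z)) (at t within T)"
      by (rule has_field_derivative_transform_within[OF _ zero_less_one t]) (simp only: P)
  qed
qed

lemma interval_nontrivial_at_within:
  fixes T :: "real set"
  assumes "is_interval T" "interior T \<noteq> {}" "t \<in> T"
  shows "at t within T \<noteq> bot"
proof -
  have "T \<noteq> {z}" for z using assms(2) by auto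
  then have "t islimpt T"
    using connected_imp_perfect[OF is_interval_connected[OF assms(1)] assms(3)] by blast
  then show ?thesis by (simp add: trivial_limit_within)
qed

section \<open>The entropy inequality\<close>

theorem theorem3p9:
  fixes f U \<F> :: "real \<Rightarrow> real" and fh :: "real \<Rightarrow> real \<Rightarrow> real"
    and k N :: nat and x :: "nat \<Rightarrow> real" and \<beta> :: real
    and gl gr :: "real \<Rightarrow> real" and T :: "real set" and u :: "real \<Rightarrow> nat \<Rightarrow> real poly"
  assumes "smooth_fun f"
    and "C_diff 3 U" and "\<And>w. (deriv ^^ 2) U w > 0"
    and "\<And>w. (\<F> has_real_derivative deriv U w * deriv f w) (at w)"
    and "k \<ge> 1" and "mesh N x"
    and "beta_admissible k \<beta>"
    and "E_flux f fh"
    and "is_interval T" and "interior T \<noteq> {}"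
    and "scheme_B k N x f fh \<beta> U gl gr T u"
  shows "\<forall>t\<in>T. \<forall>j\<in>{1..N}.
    \<exists>D. ((\<lambda>s. integral (cell x j) (\<lambda>y. U (poly (u s j) y))) has_real_derivative D) (at t within T) \<and>
        D + num_entropy_flux U f \<F> fh (trace_minus x (gl t) (u t) j) (trace_plus N x (gr t) (u t) j)
          - num_entropy_flux U f \<F> fh (trace_minus x (gl t) (u t) (j - 1))
              (trace_plus N x (gr t) (u t) (j - 1)) \<le> 0"
proof (intro ballI)
  fix t j assume t: "t \<in> T" and j: "j \<in> {1..N}"
  define a b p where "a = x (j - 1)" and "b = x j" and "p = u t j"
  have ab: "a < b"
    using \<open>mesh N x\<close> j by (cases j) (auto simp: mesh_def a_def b_def)
  have cell: "cell x j = {a..b}" by (simp add: cell_def a_def b_def)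
  have f: "(f has_real_derivative deriv f w) (at w)" for w
    using C_diff_DERIV[of 1 f 0 w] \<open>smooth_fun f\<close> by (simp add: smooth_fun_def)
  have f': "continuous_on UNIV (deriv f)"
    using \<open>smooth_fun f\<close>[unfolded smooth_fun_def C_diff_def, rule_format, of 1] by simp
  have U: "(U has_real_derivative deriv U w) (at w)"
    and U1: "(deriv U has_real_derivative (deriv ^^ 2) U w) (at w)" for w
    using C_diff_DERIV[OF \<open>C_diff 3 U\<close>, of 0 w] C_diff_DERIV[OF \<open>C_diff 3 U\<close>, of 1 w]
    by (simp_all add: numeral_2_eq_2)
  have U2: "continuous_on UNIV ((deriv ^^ 2) U)"
    using continuous_on_DERIV_comp[OF C_diff_DERIV[OF \<open>C_diff 3 U\<close>, of 2] continuous_on_id] by simp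
  note sch_t = \<open>scheme_B k N x f fh \<beta> U gl gr T u\<close>[unfolded scheme_B_def, THEN bspec]
  have deg: "degree (u s j) \<le> k" if "s \<in> T" for s
    using sch_t[OF that, THEN conjunct1] j by (simp add: Vk_def)
  note sch_j = sch_t[OF t, THEN conjunct2, THEN bspec, OF j]
  have diff: "(\<lambda>s. poly (u s j) y) differentiable (at t within T)" if "y \<in> {a..b}" for y
    using sch_j[THEN conjunct1, unfolded cell, THEN bspec, OF that] .
  have nontrivial: "at t within T \<noteq> bot"
    by (rule interval_nontrivial_at_within[OF \<open>is_interval T\<close> \<open>interior T \<noteq> {}\<close> t])
  obtain q where q: "degree q \<le> k"
    "\<And>y. y \<in> {a..b} \<Longrightarrow> vector_derivative (\<lambda>s. poly (u s j) y) (at t within T) = poly q y"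
    and "((\<lambda>s. integral {a..b} (\<lambda>y. U (poly (u s j) y))) has_real_derivative
      integral {a..b} (\<lambda>y. deriv U (poly (u t j) y) * poly q y)) (at t within T)"
    by (rule time_derivative_of_cell_polynomial[OF ab t nontrivial deg diff U U1 U2]) blast+
  then have dU: "((\<lambda>s. integral {a..b} (\<lambda>y. U (poly (u s j) y))) has_real_derivative
      integral {a..b} (\<lambda>y. deriv U (poly p y) * poly q y)) (at t within T)"
    by (simp only: p_def)
  define ml mr pl pr where "ml = trace_minus x (gl t) (u t) (j - 1)" and "mr = trace_plus N x (gr t) (u t) j"
    and "pl = poly p a" and "pr = poly p b"
  have traces: "trace_plus N x (gr t) (u t) (j - 1) = pl" "trace_minus x (gl t) (u t) j = pr"
    using j by (auto simp: trace_plus_def trace_minus_def pl_def pr_def p_def a_def b_def)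
  define fl fr where "fl = fh ml pl" and "fr = fh pr mr"
  have fluxes: "flux_at N x fh (gl t) (gr t) (u t) (j - 1) = fl" "flux_at N x fh (gl t) (gr t) (u t) j = fr"
    by (simp_all only: flux_at_def traces ml_def mr_def fl_def fr_def)
  define B where "B = damping k N x f fh \<beta> (gl t) (gr t) (u t) U j"
  have scheme: "integral {a..b} (\<lambda>y. poly q y * poly v y) - integral {a..b} (\<lambda>y. f (poly p y) * poly (pderiv v) y)
        + fr * poly v b - fl * poly v a
      = - B * integral {a..b} (\<lambda>y. (poly p y - cell_avg a b (poly p)) * poly v y)" if "degree v \<le> k" for v
  proof -
    \<comment> \<open>The scheme decouples: only the restriction of the test function to the cell enters.\<close>
    have "(\<lambda>_. v) \<in> Vk k N" using that by (simp add: Vk_def)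
    then have "integral {a..b} (\<lambda>y. vector_derivative (\<lambda>s. poly (u s j) y) (at t within T) * poly v y)
        - integral {a..b} (\<lambda>y. f (poly p y) * poly (pderiv v) y) + fr * poly v b - fl * poly v a
      = - B * integral {a..b} (\<lambda>y. (poly p y - cell_avg a b (poly p)) * poly v y)"
      using sch_j[THEN conjunct2, THEN bspec, of "\<lambda>_. v"]
      unfolding fluxes cell B_def p_def a_def b_def by simp
    moreover have "integral {a..b} (\<lambda>y. vector_derivative (\<lambda>s. poly (u s j) y) (at t within T) * poly v y)
      = integral {a..b} (\<lambda>y. poly q y * poly v y)"
      by (rule integral_cong) (simp add: q(2))
    ultimately show ?thesis by simp
  qed
  have "integral {a..b} (\<lambda>y. deriv U (poly p y) * poly q y)
    + (deriv U pr * fr - entropy_potential U f \<F> pr) - (deriv U pl * fl - entropy_potential U f \<F> pl) \<le> 0"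
    unfolding pl_def pr_def
  proof (rule cell_entropy_inequality[OF ab _ q(1) f f' \<open>C_diff 3 U\<close> assms(3,4) \<open>k \<ge> 1\<close> \<open>beta_admissible k \<beta>\<close> _ scheme])
    show "degree p \<le> k" using deg[OF t] by (simp add: p_def)
  next
    show "B = (SUP y\<in>{a..b}. \<bar>(deriv ^^ 3) U (poly p y)\<bar>) / (INF y\<in>{a..b}. \<bar>(deriv ^^ 2) U (poly p y)\<bar>)
      * (C_opt k / (2 * sqrt (b - a)) * L2_norm_on a b (\<lambda>y. deriv (\<lambda>y. f (poly p y)) y
            - poly (l2_proj k a b (deriv (\<lambda>y. f (poly p y)))) y)
         + \<beta> / (2 * (b - a)) * (\<bar>fl - f (poly p a)\<bar> + \<bar>- fr + f (poly p b)\<bar>))"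
      unfolding B_def damping_def Let_def cell fluxes traces
      unfolding a_def b_def p_def pl_def pr_def by (rule refl)
  qed
  moreover have "deriv U pl * fl - entropy_potential U f \<F> pl \<le> num_entropy_flux U f \<F> fh ml pl"
    unfolding fl_def by (rule E_flux_entropy_jump[OF \<open>E_flux f fh\<close> assms(4) f U1 assms(3)])
  ultimately have "integral {a..b} (\<lambda>y. deriv U (poly p y) * poly q y)
    + num_entropy_flux U f \<F> fh pr mr - num_entropy_flux U f \<F> fh ml pl \<le> 0"
    by (simp add: num_entropy_flux_def fr_def)
  then show "\<exists>D. ((\<lambda>s. integral (cell x j) (\<lambda>y. U (poly (u s j) y))) has_real_derivative D) (at t within T) \<and>
        D + num_entropy_flux U f \<F> fh (trace_minus x (gl t) (u t) j) (trace_plus N x (gr t) (u t) j)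
          - num_entropy_flux U f \<F> fh (trace_minus x (gl t) (u t) (j - 1))
              (trace_plus N x (gr t) (u t) (j - 1)) \<le> 0"
    using dU unfolding cell traces ml_def[symmetric] mr_def[symmetric] by blast
qed

end
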